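(* For each $j\in\{\mathrm A,\mathrm B,\mathrm C\}$ let $R_j$ be either of the problems $P_j$ or $Q_j$. Then $$\operatorname{SCI}^{\lim,\mathrm{mv}}_{\mathrm{Comp}}(R_{\mathrm A})=0,\qquad \operatorname{SCI}^{\lim,\mathrm{mv}}_{\mathrm{Comp}}(R_{\mathrm B})=1,\qquad \operatorname{SCI}^{\lim,\mathrm{mv}}_{\mathrm{Comp}}(R_{\mathrm C})=2.$$ In each case, with $k$ the stated height, one computable functional $K$ produces the entire array required by the pure normal form: $\operatorname{Lim}^{(k)}\circ K$ is defined (all successive limit-domain conditions hold) on every input name and yields a name of a permissible answer.
   Context: Type-2 conventions. $\mathbb N=\{0,1,2,\dots\}$; computable codings of rationals and finite tuples, and computable pairings $\langle\cdot,\cdot\rangle$ on $\mathbb N$ and on Baire space $\mathbb N^{\mathbb N}$, are fixed. A representation is a partial surjection $\delta_X:\subseteq\mathbb N^{\mathbb N}\to X$. Real Cauchy representation: $\rho(p)=x$ iff $|r_j-x|\leq2^{-j}$ for all $j$, $r_j$ the rational coded by $p(j)$. $\operatorname{Lim}(P)(j)=\lim_sP(\langle s,j\rangle)$, with domain those $P$ all of whose columns $s\mapsto P(\langle s,j\rangle)$ are eventually constant; $\operatorname{Lim}^{(0)}=\mathrm{id}$, $\operatorname{Lim}^{(k+1)}=\operatorname{Lim}\circ\operatorname{Lim}^{(k)}$. Payloads. $\delta_C$ names $h\in C([0,1],\mathbb R)$ by sequences of (codes of) rational polygonal functions $P_n$ with $\|P_n-h\|_\infty\leq2^{-n}$. A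 negative name of a closed interval $J\subseteq[0,1]$ enumerates rational relatively open intervals of $[0,1]$ with union $[0,1]\setminus J$ (padding allowed). Let $\mathcal H=\{h\in C([0,1],\mathbb R):h(0)<0<h(1),\ h^{-1}(0)\subseteq[1/3,2/3]\}$ with $\delta_H$ the restriction of $\delta_C$, and $\mathcal J=\{[a,b]:1/3\leq a\leq b\leq2/3\}$ with $\delta_J$ the restricted negative-information representation; $D_H=\operatorname{dom}(\delta_H)$, $D_J=\operatorname{dom}(\delta_J)$, $Z(h)=h^{-1}(0)$. Define - $D^H_{\mathrm A}=\{\langle u,v\rangle:u\in D_H,\rho(v)\in Z(\delta_H(u))\}$, $h_{\mathrm A}(\langle u,v\rangle)=\delta_H(u)$; $D^H_{\mathrm B}=D_H$, $h_{\mathrm B}(u)=\delta_H(u)$; $D^H_{\mathrm C}=\{p\in\operatorname{dom}(\operatorname{Lim}):\operatorname{Lim}(p)\in D_H\}$, $h_{\mathrm C}(p)=\delta_H(\operatorname{Lim}(p))$. - $D^J_{\mathrm A}=\{\langle q,v\rangle:q\in D_J,\rho(v)\in\delta_J(q)\}$, $J_{\mathrm A}(\langle q,v\rangle)=\delta_J(q)$; $D^J_{\mathrm B}=D_J$, $J_{\mathrm B}(q)=\delta_J(q)$; $D^J_{\mathrm C}=\{q\in\operatorname{dom}(\operatorname{Lim}):\operatorname{Lim}(q)\in D_J\}$, $J_{\mathrm C}(q)=\delta_J(\operatorname{Lim}(q))$. Coding and shift. $\tau(b)=\sum_{n\geq0}2b(n)3^{-(n+1)}$ for $b\in2^{\mathbb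 N}$; $\kappa(p)=\tau(0^{p(0)}1\,0^{p(1)}1\,0^{p(2)}1\cdots)$ for $p\in\mathbb N^{\mathbb N}$; $t(b)=\frac14+\frac18\tau(b)$; $\ell=\frac14$. Problems, $j\in\{\mathrm A,\mathrm B,\mathrm C\}$: $P_j$ has domain $D^H_j\times2^{\mathbb N}$ and relation $F_j(p,b)=t(b)+\ell Z(h_j(p))$; $Q_j$ has domain $D^J_j\times2^{\mathbb N}$ and relation $G_j(q,b)=t(b)+\ell J_j(q)$; outputs in $[0,1]$ with the usual metric and representation $\rho$. In all cases the evaluations are $\lambda_*(w,b)=\kappa(w)$ and $\lambda_n(w,b)=b(n)$ ($n\in\mathbb N$). The evaluation table $(\kappa(w),b(0),b(1),\dots)$ determines $(w,b)$; the information space of such tables in $\mathbb R^{\mathbb N}$ carries the subspace product-Cauchy representation, and an input name is such a product-Cauchy name. Pure height. $\operatorname{SCI}^{\lim,\mathrm{mv}}_{\mathrm{Comp}}(R)$ is the least $k\in\mathbb N$ for which there is a computable (Type-2) partial functional $K$ on $\mathbb N^{\mathbb N}$ such that for every input name $p$ of every input $x$ of $R$, $\operatorname{Lim}^{(k)}(K(p))$ is defined and is a $\rho$-name of an element of the solution set of $x$ ($\infty$ if no such $k$). *)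

theory Defs
  imports
    Complex_Main
    "HOL-Library.Nat_Bijection"
    "HOL-Library.Countable"
    "HOL-Library.FuncSet"
    "HOL-Library.Extended_Nat"
begin

type_synonym baire = "nat \<Rightarrow> nat"
type_synonym cantor = "nat \<Rightarrow> bool"

section \<open>Type-2 computability\<close>

text \<open>
  Partial recursive functions relative to a point \<open>p\<close> of Baire space, as Kleene schemes:
  \<open>Query\<close> reads \<open>p\<close>. The relation \<open>runs p e xs y\<close> says that the scheme \<open>e\<close> with access to \<open>p\<close>
  halts on the arguments \<open>xs\<close> with value \<open>y\<close>.
\<close>

datatype scheme =
    Zero
  | Succ
  | Proj nat
  | Query
  | Comp scheme "scheme list"
  | PrimRec scheme scheme
  | Minim scheme

inductive runs :: "baire \<Rightarrow> scheme \<Rightarrow> nat list \<Rightarrow> nat \<Rightarrow> bool" for p :: baire where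
  Zero: "runs p Zero xs 0"
| Succ: "runs p Succ [x] (Suc x)"
| Proj: "i < length xs \<Longrightarrow> runs p (Proj i) xs (xs ! i)"
| Query: "runs p Query [x] (p x)"
| Comp: "\<lbrakk>length ys = length gs; \<forall>i<length gs. runs p (gs ! i) xs (ys ! i); runs p f ys y\<rbrakk>
    \<Longrightarrow> runs p (Comp f gs) xs y"
| PrimRec_0: "runs p f xs y \<Longrightarrow> runs p (PrimRec f g) (0 # xs) y"
| PrimRec_Suc: "\<lbrakk>runs p (PrimRec f g) (n # xs) r; runs p g (n # r # xs) y\<rbrakk>
    \<Longrightarrow> runs p (PrimRec f g) (Suc n # xs) y"
| Minim: "\<lbrakk>runs p f (n # xs) 0; \<forall>m<n. \<exists>y. runs p f (m # xs) (Suc y)\<rbrakk>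
    \<Longrightarrow> runs p (Minim f) xs n"

lemma runs_deterministic:
  assumes "runs p e xs y" "runs p e xs z"
  shows "y = z"
  using assms
proof (induction arbitrary: z rule: runs.induct)
  case (Comp ys gs xs f y)
  from Comp.prems obtain ys' where ys': "length ys' = length gs"
    "\<forall>i<length gs. runs p (gs ! i) xs (ys' ! i)" "runs p f ys' z"
    by (cases rule: runs.cases) auto
  have "ys = ys'"
    by (rule nth_equalityI) (use Comp ys' in auto)
  with Comp ys' show ?case by auto
next
  case (PrimRec_0 f xs y g)
  from PrimRec_0.prems show ?case
    by (cases rule: runs.cases) (use PrimRec_0.IH in auto)
next
  case (PrimRec_Suc f g n xs r y)
  from PrimRec_Suc.prems show ?case
    by (cases rule: runs.cases) (use PrimRec_Suc.IH in auto)
next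
  case (Minim f n xs)
  from Minim.prems have z: "runs p f (z # xs) 0" "\<forall>m<z. \<exists>y. runs p f (m # xs) (Suc y)"
    by (cases rule: runs.cases; auto)+
  show ?case
  proof (rule linorder_cases[of n z])
    assume "n < z"
    with z obtain y where "runs p f (n # xs) (Suc y)" by blast
    with Minim.IH(1) show ?thesis by blast
  next
    assume "z < n"
    with Minim.IH(2) z(1) show ?thesis by blast
  qed
qed (auto elim: runs.cases)

text \<open>
  The domain of the functional computed by \<open>e\<close> is its natural one: all \<open>p\<close> on which every
  output cell is produced.
\<close>

definition type2_computable :: "(baire \<rightharpoonup> baire) \<Rightarrow> bool" where
  "type2_computable K \<longleftrightarrow> (\<exists>e. \<forall>p q. K p = Some q \<longleftrightarrow> (\<forall>n. runs p e [n] (q n)))"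


section \<open>Limit operators\<close>

definition Lim :: "baire \<rightharpoonup> baire" where
  "Lim P =
    (if \<forall>j. \<exists>c. \<forall>\<^sub>F s in sequentially. P (prod_encode (s, j)) = c
     then Some (\<lambda>j. THE c. \<forall>\<^sub>F s in sequentially. P (prod_encode (s, j)) = c)
     else None)"

primrec Lim_iter :: "nat \<Rightarrow> baire \<rightharpoonup> baire" where
  "Lim_iter 0 = Some"
| "Lim_iter (Suc k) = Lim \<circ>\<^sub>m Lim_iter k"

lemma Lim_eq_Some_iff:
  "Lim P = Some q \<longleftrightarrow> (\<forall>j. \<forall>\<^sub>F s in sequentially. P (prod_encode (s, j)) = q j)"
proof -
  have unique: "c = d" if "\<forall>\<^sub>F s in sequentially. P (prod_encode (s, j)) = c"
    "\<forall>\<^sub>F s in sequentially. P (prod_encode (s, j)) = d" for c d j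
  proof -
    have "\<forall>\<^sub>F s::nat in sequentially. c = d"
      using that by eventually_elim auto
    then show ?thesis by simp
  qed
  have the: "(THE c. \<forall>\<^sub>F s in sequentially. P (prod_encode (s, j)) = c) = c"
    if "\<forall>\<^sub>F s in sequentially. P (prod_encode (s, j)) = c" for j c
    using that unique by blast
  show ?thesis
  proof
    assume L: "Lim P = Some q"
    then have ex: "\<forall>j. \<exists>c. \<forall>\<^sub>F s in sequentially. P (prod_encode (s, j)) = c"
      by (simp add: Lim_def split: if_splits)
    with L have q: "q = (\<lambda>j. THE c. \<forall>\<^sub>F s in sequentially. P (prod_encode (s, j)) = c)"
      unfolding Lim_def by simp
    show "\<forall>j. \<forall>\<^sub>F s in sequentially. P (prod_encode (s, j)) = q j"
    proof
      fix j
      from ex obtain c where c: "\<forall>\<^sub>F s in sequentially. P (prod_encode (s, j)) = c" by blast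
      with the[OF c] show "\<forall>\<^sub>F s in sequentially. P (prod_encode (s, j)) = q j"
        unfolding q by simp
    qed
  next
    assume q: "\<forall>j. \<forall>\<^sub>F s in sequentially. P (prod_encode (s, j)) = q j"
    then have "(\<lambda>j. THE c. \<forall>\<^sub>F s in sequentially. P (prod_encode (s, j)) = c) = q"
      using the by blast
    with q show "Lim P = Some q"
      unfolding Lim_def by auto
  qed
qed


section \<open>Representations\<close>

text \<open>
  A representation is a partial map \<open>baire \<rightharpoonup> 'x\<close>. It is given by its naming relation, which
  has to be single-valued; this is proved below for each relation in use.
\<close>

definition rep_of :: "(baire \<Rightarrow> 'x \<Rightarrow> bool) \<Rightarrow> baire \<rightharpoonup> 'x" where
  "rep_of N p = (if \<exists>x. N p x then Some (THE x. N p x) else None)"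

definition rep_restrict :: "(baire \<rightharpoonup> 'x) \<Rightarrow> 'x set \<Rightarrow> baire \<rightharpoonup> 'x" where
  "rep_restrict \<delta> X = \<delta> |` {p. \<exists>x\<in>X. \<delta> p = Some x}"

lemma rep_of_eq_Some_iff:
  assumes "\<And>p x y. N p x \<Longrightarrow> N p y \<Longrightarrow> x = y"
  shows "rep_of N p = Some x \<longleftrightarrow> N p x"
proof -
  have "(THE x. N p x) = x" if "N p x" for x
    using that assms by blast
  then show ?thesis by (auto simp: rep_of_def)
qed

lemma rep_restrict_eq_Some_iff:
  "rep_restrict \<delta> X p = Some x \<longleftrightarrow> \<delta> p = Some x \<and> x \<in> X"
  by (auto simp: rep_restrict_def restrict_map_def)

text \<open>The coding of the rationals is \<^const>\<open>nat_to_rat_surj\<close> from the library.\<close>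

definition cauchy_names :: "baire \<Rightarrow> real \<Rightarrow> bool" where
  "cauchy_names p x \<longleftrightarrow> (\<forall>j. \<bar>of_rat (nat_to_rat_surj (p j)) - x\<bar> \<le> (1 / 2) ^ j)"

definition rho :: "baire \<rightharpoonup> real" where
  "rho = rep_of cauchy_names"

lemma eq_if_dist_le_geometric:
  fixes x y :: real
  assumes "\<And>j. \<bar>r j - x\<bar> \<le> (1 / 2) ^ j" "\<And>j. \<bar>r j - y\<bar> \<le> (1 / 2) ^ j"
  shows "x = y"
proof (rule ccontr)
  assume "x \<noteq> y"
  then obtain j where "(1 / 2) ^ j < \<bar>x - y\<bar> / 2"
    using real_arch_pow_inv[of "\<bar>x - y\<bar> / 2" "1 / 2"] by auto
  moreover have "\<bar>x - y\<bar> \<le> \<bar>r j - x\<bar> + \<bar>r j - y\<bar>" by linarith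
  ultimately show False using assms(1)[of j] assms(2)[of j] by argo
qed

lemma rho_eq_Some_iff: "rho p = Some x \<longleftrightarrow> cauchy_names p x"
  unfolding rho_def
  by (rule rep_of_eq_Some_iff) (unfold cauchy_names_def, rule eq_if_dist_le_geometric, blast+)


section \<open>Continuous functions on the unit interval\<close>

text \<open>
  A code of a polygonal function lists its nodes, with strictly increasing abscissae running
  from \<open>0\<close> to \<open>1\<close>. Elements of \<open>C01\<close> are \<^const>\<open>undefined\<close> outside the unit interval, so that
  equality in \<open>C01\<close> is equality on the unit interval.
\<close>

definition C01 :: "(real \<Rightarrow> real) set" where
  "C01 = {h. continuous_on {0..1} h \<and> h \<in> extensional {0..1}}"

definition nodes_of_code :: "nat \<Rightarrow> (rat \<times> rat) list" where
  "nodes_of_code c = map (map_prod nat_to_rat_surj nat_to_rat_surj \<circ> prod_decode) (list_decode c)"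

definition valid_nodes :: "(rat \<times> rat) list \<Rightarrow> bool" where
  "valid_nodes ns \<longleftrightarrow>
    ns \<noteq> [] \<and> fst (hd ns) = 0 \<and> fst (last ns) = 1 \<and> sorted_wrt (<) (map fst ns)"

fun polygonal :: "(rat \<times> rat) list \<Rightarrow> real \<Rightarrow> real" where
  "polygonal ((a, c) # (b, d) # ns) x =
    (if x \<le> of_rat b
     then of_rat c + (x - of_rat a) * (of_rat d - of_rat c) / (of_rat b - of_rat a)
     else polygonal ((b, d) # ns) x)"
| "polygonal [(a, c)] x = of_rat c"
| "polygonal [] x = 0"

definition C_names :: "baire \<Rightarrow> (real \<Rightarrow> real) \<Rightarrow> bool" where
  "C_names u h \<longleftrightarrow> h \<in> C01 \<and>
    (\<forall>n. valid_nodes (nodes_of_code (u n)) \<and>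
      (\<forall>x\<in>{0..1}. \<bar>polygonal (nodes_of_code (u n)) x - h x\<bar> \<le> (1 / 2) ^ n))"

definition delta_C :: "baire \<rightharpoonup> (real \<Rightarrow> real)" where
  "delta_C = rep_of C_names"

lemma delta_C_eq_Some_iff: "delta_C u = Some h \<longleftrightarrow> C_names u h"
  unfolding delta_C_def
proof (rule rep_of_eq_Some_iff)
  fix u g h assume "C_names u g" "C_names u h"
  then have ext: "g \<in> extensional {0..1}" "h \<in> extensional {0..1}"
    and near: "\<And>x n. x \<in> {0..1} \<Longrightarrow> \<bar>polygonal (nodes_of_code (u n)) x - g x\<bar> \<le> (1 / 2) ^ n"
      "\<And>x n. x \<in> {0..1} \<Longrightarrow> \<bar>polygonal (nodes_of_code (u n)) x - h x\<bar> \<le> (1 / 2) ^ n"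
    unfolding C_names_def C01_def by blast+
  have "g x = h x" if "x \<in> {0..1}" for x
    using near[OF that] by (rule eq_if_dist_le_geometric)
  with ext show "g = h" by (rule extensionalityI)
qed

definition zeros :: "(real \<Rightarrow> real) \<Rightarrow> real set" where
  "zeros h = {x\<in>{0..1}. h x = 0}"

definition H_space :: "(real \<Rightarrow> real) set" where
  "H_space = {h\<in>C01. h 0 < 0 \<and> 0 < h 1 \<and> zeros h \<subseteq> {1/3..2/3}}"

definition delta_H :: "baire \<rightharpoonup> (real \<Rightarrow> real)" where
  "delta_H = rep_restrict delta_C H_space"


section \<open>Closed intervals by negative information\<close>

text \<open>
  Every rational relatively open interval of the unit interval, including the half-open ones
  at its ends, has a code; codes with empty intersection serve as padding.
\<close>

definition open_of_code :: "nat \<Rightarrow> real set" where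
  "open_of_code c = (case prod_decode c of (m, n) \<Rightarrow>
    {of_rat (nat_to_rat_surj m)<..<of_rat (nat_to_rat_surj n)} \<inter> {0..1})"

definition neg_names :: "baire \<Rightarrow> real set \<Rightarrow> bool" where
  "neg_names q J \<longleftrightarrow> (\<exists>a b. 0 \<le> a \<and> a \<le> b \<and> b \<le> 1 \<and> J = {a..b}) \<and>
    (\<Union>n. open_of_code (q n)) = {0..1} - J"

definition delta_neg :: "baire \<rightharpoonup> real set" where
  "delta_neg = rep_of neg_names"

lemma delta_neg_eq_Some_iff: "delta_neg q = Some J \<longleftrightarrow> neg_names q J"
  unfolding delta_neg_def
proof (rule rep_of_eq_Some_iff)
  fix q I J assume "neg_names q I" "neg_names q J"
  then have "I \<subseteq> {0..1}" "J \<subseteq> {0..1}" "{0..1} - I = {0..1} - J"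
    by (auto simp: neg_names_def)
  then show "I = J" by blast
qed

definition J_space :: "real set set" where
  "J_space = {{a..b} | a b. 1/3 \<le> a \<and> a \<le> b \<and> b \<le> 2/3}"

definition delta_J :: "baire \<rightharpoonup> real set" where
  "delta_J = rep_restrict delta_neg J_space"


section \<open>Payloads\<close>

definition bpair :: "baire \<Rightarrow> baire \<Rightarrow> baire" where
  "bpair u v n = (if even n then u (n div 2) else v (n div 2))"

definition bfst :: "baire \<Rightarrow> baire" where
  "bfst p n = p (2 * n)"

lemma bfst_bpair [simp]: "bfst (bpair u v) = u"
  by (simp add: bfst_def bpair_def fun_eq_iff)

datatype tier = Tier_A | Tier_B | Tier_C

fun D_H :: "tier \<Rightarrow> baire set" where
  "D_H Tier_A = {bpair u v | u v. u \<in> dom delta_H \<and> v \<in> dom rho \<and> the (rho v) \<in> zeros (the (delta_H u))}"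
| "D_H Tier_B = dom delta_H"
| "D_H Tier_C = {p \<in> dom Lim. the (Lim p) \<in> dom delta_H}"

fun payload_H :: "tier \<Rightarrow> baire \<Rightarrow> (real \<Rightarrow> real)" where
  "payload_H Tier_A p = the (delta_H (bfst p))"
| "payload_H Tier_B p = the (delta_H p)"
| "payload_H Tier_C p = the (delta_H (the (Lim p)))"

fun D_J :: "tier \<Rightarrow> baire set" where
  "D_J Tier_A = {bpair q v | q v. q \<in> dom delta_J \<and> v \<in> dom rho \<and> the (rho v) \<in> the (delta_J q)}"
| "D_J Tier_B = dom delta_J"
| "D_J Tier_C = {q \<in> dom Lim. the (Lim q) \<in> dom delta_J}"

fun payload_J :: "tier \<Rightarrow> baire \<Rightarrow> real set" where
  "payload_J Tier_A q = the (delta_J (bfst q))"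
| "payload_J Tier_B q = the (delta_J q)"
| "payload_J Tier_C q = the (delta_J (the (Lim q)))"


section \<open>Coding and shift\<close>

definition tau :: "cantor \<Rightarrow> real" where
  "tau b = (\<Sum>n. 2 * of_bool (b n) / 3 ^ (n + 1))"

text \<open>
  The blocks are \<open>p i\<close> zeros followed by a one. The first \<open>n + 1\<close> blocks have total length
  greater than \<open>n\<close>, so they determine bit \<open>n\<close> of the infinite concatenation.
\<close>

definition unary_bits :: "baire \<Rightarrow> cantor" where
  "unary_bits p n = concat (map (\<lambda>i. replicate (p i) False @ [True]) [0..<Suc n]) ! n"

definition kappa :: "baire \<Rightarrow> real" where
  "kappa p = tau (unary_bits p)"

definition shift :: "cantor \<Rightarrow> real" where
  "shift b = 1/4 + 1/8 * tau b"

definition ell :: real where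
  "ell = 1/4"


section \<open>Computational problems and pure height\<close>

text \<open>
  The evaluations of a problem are indexed by \<^typ>\<open>nat\<close>, in the order in which they occur in
  the evaluation table. An input name is a product-Cauchy name of the table; its
  \<open>n\<close>-th component is \<open>\<lambda>j. p \<langle>n, j\<rangle>\<close>.
\<close>

record 'i problem =
  inputs :: "'i set"
  solutions :: "'i \<Rightarrow> real set"
  evaluation :: "nat \<Rightarrow> 'i \<Rightarrow> real"

definition table :: "('i, 'z) problem_scheme \<Rightarrow> 'i \<Rightarrow> nat \<Rightarrow> real" where
  "table R x = (\<lambda>n. evaluation R n x)"

definition product_cauchy_name :: "baire \<Rightarrow> (nat \<Rightarrow> real) \<Rightarrow> bool" where
  "product_cauchy_name p y \<longleftrightarrow> (\<forall>n. rho (\<lambda>j. p (prod_encode (n, j))) = Some (y n))"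

definition input_name :: "('i, 'z) problem_scheme \<Rightarrow> baire \<Rightarrow> 'i \<Rightarrow> bool" where
  "input_name R p x \<longleftrightarrow> x \<in> inputs R \<and> product_cauchy_name p (table R x)"

definition solves_at_height :: "(baire \<rightharpoonup> baire) \<Rightarrow> nat \<Rightarrow> ('i, 'z) problem_scheme \<Rightarrow> bool" where
  "solves_at_height K k R \<longleftrightarrow>
    (\<forall>x p. input_name R p x \<longrightarrow>
      (\<exists>q r y. K p = Some q \<and> Lim_iter k q = Some r \<and> rho r = Some y \<and> y \<in> solutions R x))"

text \<open>On \<^typ>\<open>enat\<close> the infimum of the empty set is \<open>\<infinity>\<close>.\<close>

definition SCI_lim_mv_Comp :: "('i, 'z) problem_scheme \<Rightarrow> enat" where
  "SCI_lim_mv_Comp R = Inf {enat k | k. \<exists>K. type2_computable K \<and> solves_at_height K k R}"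

fun evaluations :: "nat \<Rightarrow> baire \<times> cantor \<Rightarrow> real" where
  "evaluations 0 (w, b) = kappa w"
| "evaluations (Suc n) (w, b) = of_bool (b n)"

definition problem_P :: "tier \<Rightarrow> (baire \<times> cantor) problem" where
  "problem_P j = \<lparr>inputs = D_H j \<times> UNIV,
    solutions = (\<lambda>(p, b). (\<lambda>z. shift b + ell * z) ` zeros (payload_H j p)),
    evaluation = evaluations\<rparr>"

definition problem_Q :: "tier \<Rightarrow> (baire \<times> cantor) problem" where
  "problem_Q j = \<lparr>inputs = D_J j \<times> UNIV,
    solutions = (\<lambda>(q, b). (\<lambda>z. shift b + ell * z) ` payload_J j q),
    evaluation = evaluations\<rparr>"

lemma tau_bounds: "0 \<le> tau b" "tau b \<le> 1"
proof -
  have geo: "(\<lambda>n. 2 / 3 ^ (n + 1)) sums (1::real)"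
    using sums_mult[OF geometric_sums[of "1/3 :: real"], of "2/3"]
    by (simp add: power_divide)
  have le: "2 * of_bool (b n) / 3 ^ (n + 1) \<le> (2 / 3 ^ (n + 1) :: real)" for n
    by (auto simp: divide_right_mono)
  have summable: "summable (\<lambda>n. 2 * of_bool (b n) / 3 ^ (n + 1) :: real)"
    using sums_summable[OF geo] by (rule summable_comparison_test') (use le in auto)
  show "0 \<le> tau b"
    unfolding tau_def by (rule suminf_nonneg[OF summable]) simp
  show "tau b \<le> 1"
    unfolding tau_def sums_unique[OF geo]
    by (rule suminf_le[OF le summable sums_summable[OF geo]])
qed

lemma shift_scale_in_unit_interval:
  "z \<in> {0..1} \<Longrightarrow> shift b + ell * z \<in> {0..1}"
  using tau_bounds[of b] by (auto simp: shift_def ell_def)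

end

theory Submission
  imports Defs
begin

text \<open>
  The evaluation table determines the input computably: the ternary digits of \<open>kappa w\<close> are all
  \<open>0\<close> or \<open>2\<close>, so a sufficiently close rational approximation reveals each of them, and the
  numbers of zeros between consecutive nonzero digits are the values of \<open>w\<close>. Hence an algorithm may be thought of
  as having \<open>w\<close> and \<open>b\<close> at its disposal, and the shift by \<open>b\<close> is harmless because it can be
  computed to any precision. What is left is the task of choosing a point of the set \<open>Z w\<close> named by
  \<open>w\<close>, which is a zero set for the problems \<open>P\<close> and an interval for the problems \<open>Q\<close>. All bounds are
  proved for an arbitrary partial map \<open>Z\<close> (\<open>choice_problem\<close>) from properties of \<open>Z\<close> that both
  examples share.

  Upper bounds. When a name of a point of the set is part of the input, its rational approximations are
  passed on (\<open>height_0_if_point_given\<close>). Otherwise a point is found by bisection, where each step asks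
  whether a dyadic point lies to the left of the target: for a function \<open>h\<close> whether \<open>h\<close> is
  negative there, for an interval whether everything up to that point is covered by the
  enumerated open sets. Both answers are limits of decidable tests with
  a stage parameter, so every step of the bisection is eventually constant in the stage and one limit
  suffices (\<open>height_1_if_located\<close>). When \<open>w\<close> is only the limit of its columns, a test looks at
  finitely many entries of its oracle and therefore gives the right answer on all sufficiently
  late columns; this costs one more limit (\<open>height_2_if_located\<close>).

  Lower bounds. Both maps \<open>Z\<close> have a fork (\<open>forks\<close>): a name all of whose prefixes extend
  to a name of \<open>{1/3}\<close> and also to a name of \<open>{2/3}\<close>. A solution for \<open>{1/3}\<close> and one for \<open>{2/3}\<close> can be told
  apart by a single rational approximation. A computable functional commits itself to this approximation after
  reading a finite prefix of the forking name, and the prefix can be extended to the opposite end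
  (\<open>not_height_0_if_forks\<close>). If the payload is a limit and the algorithm may use one limit, a
  sequence of columns is built that converges to the forking name: at stage \<open>k\<close>
  the columns below \<open>k\<close> stay as they are, the others temporarily switch to the end opposite to the current
  guess, until the guess changes, and then switch back. Each column settles, but the guess
  changes infinitely often (\<open>not_height_1_if_forks\<close>).
\<close>

section \<open>A calculus of computable functions\<close>

text \<open>
  The scheme has to halt only for oracles in \<open>D\<close>, on all argument lists of length \<open>n\<close>. This is what
  unbounded search needs: decoding an input terminates only if the oracle is the name of an input.
  The argument list serves as an environment of variables, with the innermost binder in front, so
  that the closure lemmas below can be applied backwards to a term with binders.
\<close>

definition computable_on :: "baire set \<Rightarrow> nat \<Rightarrow> (baire \<Rightarrow> nat list \<Rightarrow> nat) \<Rightarrow> bool" where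
  "computable_on D n f \<longleftrightarrow> (\<exists>e. \<forall>p\<in>D. \<forall>xs. length xs = n \<longrightarrow> runs p e xs (f p xs))"

abbreviation decidable_on :: "baire set \<Rightarrow> nat \<Rightarrow> (baire \<Rightarrow> nat list \<Rightarrow> bool) \<Rightarrow> bool" where
  "decidable_on D n Q \<equiv> computable_on D n (\<lambda>p xs. of_bool (Q p xs))"

lemma computable_cong:
  assumes "computable_on D n f" "\<And>p xs. p \<in> D \<Longrightarrow> length xs = n \<Longrightarrow> g p xs = f p xs"
  shows "computable_on D n g"
  using assms unfolding computable_on_def by metis

lemma computable_weaken:
  assumes "computable_on D n f"
  shows "computable_on D (Suc n) (\<lambda>p ys. f p (tl ys))"
proof -
  obtain e where e: "\<And>p xs. p \<in> D \<Longrightarrow> length xs = n \<Longrightarrow> runs p e xs (f p xs)"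
    using assms unfolding computable_on_def by blast
  have "runs p (scheme.Comp e (map (\<lambda>i. Proj (Suc i)) [0..<n])) ys (f p (tl ys))"
    if "p \<in> D" "length ys = Suc n" for p ys
    by (rule runs.Comp[where ys = "tl ys"])
      (use that e in \<open>auto simp: nth_tl intro: runs.Proj[of "Suc _" ys, simplified]\<close>)
  then show ?thesis unfolding computable_on_def by blast
qed

lemma computable_var0: "0 < n \<Longrightarrow> computable_on D n (\<lambda>p xs. hd xs)"
  unfolding computable_on_def
  by (rule exI[of _ "Proj 0"]) (metis hd_conv_nth length_0_conv less_numeral_extra(3) runs.Proj)

lemma computable_var1: "1 < n \<Longrightarrow> computable_on D n (\<lambda>p xs. hd (tl xs))"
  by (cases n; simp add: computable_weaken[OF computable_var0])

lemma computable_var2: "2 < n \<Longrightarrow> computable_on D n (\<lambda>p xs. hd (tl (tl xs)))"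
  by (cases n; simp add: computable_weaken[OF computable_var1])

lemma computable_comp1:
  assumes "\<And>p x. runs p e [x] (F x)" "computable_on D n f"
  shows "computable_on D n (\<lambda>p xs. F (f p xs))"
proof -
  obtain d where d: "\<And>p xs. p \<in> D \<Longrightarrow> length xs = n \<Longrightarrow> runs p d xs (f p xs)"
    using assms unfolding computable_on_def by blast
  have "runs p (scheme.Comp e [d]) xs (F (f p xs))" if "p \<in> D" "length xs = n" for p xs
    by (rule runs.Comp[where ys = "[f p xs]"]) (use that d assms in auto)
  then show ?thesis unfolding computable_on_def by blast
qed

lemma computable_Suc: "computable_on D n f \<Longrightarrow> computable_on D n (\<lambda>p xs. Suc (f p xs))"
  by (rule computable_comp1[where e = scheme.Succ]) (rule runs.Succ)

lemma computable_const: "computable_on D n (\<lambda>p xs. k)"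
proof (induction k)
  case 0
  show ?case unfolding computable_on_def using runs.Zero by blast
qed (rule computable_Suc)

lemma computable_rec:
  assumes "computable_on D n f" "computable_on D n a"
    and "computable_on D (Suc (Suc n)) (\<lambda>p ys. g p (tl (tl ys)) (hd ys) (hd (tl ys)))"
  shows "computable_on D n (\<lambda>p xs. rec_nat (a p xs) (\<lambda>k r. g p xs k r) (f p xs))"
proof -
  obtain ef where ef: "\<And>p xs. p \<in> D \<Longrightarrow> length xs = n \<Longrightarrow> runs p ef xs (f p xs)"
    using assms(1) unfolding computable_on_def by blast
  obtain ea where ea: "\<And>p xs. p \<in> D \<Longrightarrow> length xs = n \<Longrightarrow> runs p ea xs (a p xs)"
    using assms(2) unfolding computable_on_def by blast
  obtain eg where eg: "\<And>p ys. p \<in> D \<Longrightarrow> length ys = Suc (Suc n) \<Longrightarrow>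
      runs p eg ys (g p (tl (tl ys)) (hd ys) (hd (tl ys)))"
    using assms(3) unfolding computable_on_def by blast
  have rec: "runs p (PrimRec ea eg) (m # xs) (rec_nat (a p xs) (\<lambda>k r. g p xs k r) m)"
    if "p \<in> D" "length xs = n" for p xs m
  proof (induction m)
    case (Suc m)
    then show ?case
      using runs.PrimRec_Suc[OF Suc] eg[OF that(1), of "m # rec_nat (a p xs) (g p xs) m # xs"] that
      by simp
  qed (simp add: runs.PrimRec_0 ea that)
  have "runs p (scheme.Comp (PrimRec ea eg) (ef # map Proj [0..<n])) xs
      (rec_nat (a p xs) (\<lambda>k r. g p xs k r) (f p xs))" if "p \<in> D" "length xs = n" for p xs
    by (rule runs.Comp[where ys = "f p xs # xs"])
      (use that ef rec in \<open>auto simp: nth_Cons' intro: runs.Proj\<close>)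
  then show ?thesis unfolding computable_on_def by blast
qed

lemma computable_add:
  assumes "computable_on D n f" "computable_on D n g"
  shows "computable_on D n (\<lambda>p xs. f p xs + g p xs)"
proof -
  have eq: "rec_nat x (\<lambda>_. Suc) y = x + y" for x y :: nat by (induction y) auto
  have "computable_on D n (\<lambda>p xs. rec_nat (f p xs) (\<lambda>k r. Suc r) (g p xs))"
    by (intro computable_rec assms computable_Suc computable_var1) simp
  then show ?thesis by (simp add: eq)
qed

lemma computable_diff:
  assumes "computable_on D n f" "computable_on D n g"
  shows "computable_on D n (\<lambda>p xs. f p xs - g p xs)"
proof -
  have eq1: "rec_nat 0 (\<lambda>k _. k) y = y - 1" for y :: nat by (induction y) auto
  have "computable_on D n (\<lambda>p xs. rec_nat 0 (\<lambda>k r. k) (f p xs))"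
    if "computable_on D n f" for n f
    by (intro computable_rec that computable_const computable_var0) simp
  then have pred: "computable_on D n (\<lambda>p xs. f p xs - 1)" if "computable_on D n f" for n f
    unfolding eq1 using that .
  have eq: "rec_nat x (\<lambda>_ r. r - 1) y = x - y" for x y :: nat by (induction y) auto
  have "computable_on D n (\<lambda>p xs. rec_nat (f p xs) (\<lambda>k r. r - 1) (g p xs))"
    by (intro computable_rec assms pred computable_var1) simp
  then show ?thesis unfolding eq .
qed

lemma computable_mult:
  assumes "computable_on D n f" "computable_on D n g"
  shows "computable_on D n (\<lambda>p xs. f p xs * g p xs)"
proof -
  have eq: "rec_nat 0 (\<lambda>_ r. r + x) y = x * y" for x y :: nat by (induction y) auto
  have "computable_on D n (\<lambda>p xs. rec_nat 0 (\<lambda>k r. r + f p xs) (g p xs))"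
    by (intro computable_rec assms computable_add computable_const computable_var1
        computable_weaken[OF computable_weaken[OF assms(1)]]) simp
  then show ?thesis unfolding eq .
qed

lemma computable_power:
  assumes "computable_on D n f" "computable_on D n g"
  shows "computable_on D n (\<lambda>p xs. f p xs ^ g p xs)"
proof -
  have eq: "rec_nat 1 (\<lambda>_ r. r * x) y = x ^ y" for x y :: nat by (induction y) auto
  have "computable_on D n (\<lambda>p xs. rec_nat 1 (\<lambda>k r. r * f p xs) (g p xs))"
    by (intro computable_rec assms computable_mult computable_const computable_var1
        computable_weaken[OF computable_weaken[OF assms(1)]]) simp
  then show ?thesis unfolding eq .
qed

lemma decidable_less:
  assumes "computable_on D n f" "computable_on D n g"
  shows "decidable_on D n (\<lambda>p xs. f p xs < g p xs)"
proof -
  have "of_bool (x < y) = 1 - (1 - (y - x))" for x y :: nat by auto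
  then show ?thesis by (simp only:) (intro computable_diff computable_const assms)
qed

lemma decidable_not:
  assumes "decidable_on D n Q"
  shows "decidable_on D n (\<lambda>p xs. \<not> Q p xs)"
proof -
  have "of_bool (\<not> b) = 1 - (of_bool b :: nat)" for b by auto
  then show ?thesis by (simp only:) (intro computable_diff computable_const assms)
qed

lemma decidable_and:
  assumes "decidable_on D n Q" "decidable_on D n Q'"
  shows "decidable_on D n (\<lambda>p xs. Q p xs \<and> Q' p xs)"
  by (simp only: of_bool_conj) (intro computable_mult assms)

lemma decidable_or:
  assumes "decidable_on D n Q" "decidable_on D n Q'"
  shows "decidable_on D n (\<lambda>p xs. Q p xs \<or> Q' p xs)"
  using decidable_not[OF decidable_and[OF decidable_not[OF assms(1)] decidable_not[OF assms(2)]]]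
  by simp

lemma decidable_imp:
  assumes "decidable_on D n Q" "decidable_on D n Q'"
  shows "decidable_on D n (\<lambda>p xs. Q p xs \<longrightarrow> Q' p xs)"
  using decidable_or[OF decidable_not[OF assms(1)] assms(2)] by (simp only: imp_conv_disj)

lemma decidable_le:
  assumes "computable_on D n f" "computable_on D n g"
  shows "decidable_on D n (\<lambda>p xs. f p xs \<le> g p xs)"
  using decidable_not[OF decidable_less[OF assms(2,1)]] by (simp add: not_less)

lemma decidable_eq:
  assumes "computable_on D n f" "computable_on D n g"
  shows "decidable_on D n (\<lambda>p xs. f p xs = g p xs)"
  using decidable_and[OF decidable_le[OF assms] decidable_le[OF assms(2,1)]]
  by (simp only: eq_iff)

lemma computable_if:
  assumes "decidable_on D n Q" "computable_on D n f" "computable_on D n g"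
  shows "computable_on D n (\<lambda>p xs. if Q p xs then f p xs else g p xs)"
proof -
  have "(if b then x else y) = of_bool b * x + (1 - of_bool b) * y" for b and x y :: nat by auto
  then show ?thesis
    by (simp only:) (intro computable_add computable_mult computable_diff computable_const assms)
qed

text \<open>
  Minimisation requires the search to succeed for every argument list, also for those that never
  occur in a computation.
\<close>

lemma computable_Least:
  assumes "decidable_on D (Suc n) (\<lambda>p ys. Q p (tl ys) (hd ys))"
    and "\<And>p xs. p \<in> D \<Longrightarrow> \<exists>k. Q p xs k"
  shows "computable_on D n (\<lambda>p xs. LEAST k. Q p xs k)"
proof -
  obtain e where e: "\<And>p ys. p \<in> D \<Longrightarrow> length ys = Suc n \<Longrightarrow>
      runs p e ys (of_bool (\<not> Q p (tl ys) (hd ys)))"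
    using decidable_not[OF assms(1)] unfolding computable_on_def by blast
  have "runs p (Minim e) xs (LEAST k. Q p xs k)" if "p \<in> D" "length xs = n" for p xs
  proof (rule runs.Minim)
    have run: "runs p e (m # xs) (of_bool (\<not> Q p xs m))" for m
      using e[OF that(1), of "m # xs"] that(2) by simp
    show "runs p e ((LEAST k. Q p xs k) # xs) 0"
      using run[of "LEAST k. Q p xs k"] LeastI_ex[OF assms(2)[OF that(1)]] by simp
    show "\<forall>m<LEAST k. Q p xs k. \<exists>y. runs p e (m # xs) (Suc y)"
      using run not_less_Least by (metis One_nat_def of_bool_eq(2))
  qed
  then show ?thesis unfolding computable_on_def by blast
qed

text \<open>
  A bounded search is an unbounded one that also stops at the bound.
\<close>

lemma decidable_bex:
  assumes "computable_on D n f" "decidable_on D (Suc n) (\<lambda>p ys. Q p (tl ys) (hd ys))"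
  shows "decidable_on D n (\<lambda>p xs. \<exists>k<f p xs. Q p xs k)"
proof -
  have eq: "(\<exists>k<m. A k) \<longleftrightarrow> (LEAST k. m \<le> k \<or> A k) < m" for m and A :: "nat \<Rightarrow> bool"
  proof
    assume "\<exists>k<m. A k"
    then show "(LEAST k. m \<le> k \<or> A k) < m" by (metis (lifting) Least_le order.strict_trans1)
  next
    assume "(LEAST k. m \<le> k \<or> A k) < m"
    moreover have "m \<le> (LEAST k. m \<le> k \<or> A k) \<or> A (LEAST k. m \<le> k \<or> A k)"
      by (rule LeastI[of _ m]) simp
    ultimately show "\<exists>k<m. A k" by auto
  qed
  show ?thesis unfolding eq
    by (intro decidable_less computable_Least decidable_or decidable_le assms computable_var0
        computable_weaken[OF assms(1)]) auto
qed

lemma decidable_ball: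
  assumes "computable_on D n f" "decidable_on D (Suc n) (\<lambda>p ys. Q p (tl ys) (hd ys))"
  shows "decidable_on D n (\<lambda>p xs. \<forall>k<f p xs. Q p xs k)"
  using decidable_not[OF decidable_bex[OF assms(1) decidable_not[OF assms(2)]]] by simp

lemma computable_div:
  assumes "computable_on D n f" "computable_on D n g"
  shows "computable_on D n (\<lambda>p xs. f p xs div g p xs)"
proof -
  have eq: "x div y = (LEAST q. y = 0 \<or> x < y * Suc q)" for x y :: nat
  proof (rule Least_equality[symmetric])
    show "y = 0 \<or> x < y * Suc (x div y)" by (metis dividend_less_times_div gr0I mult_Suc_right)
    fix q assume "y = 0 \<or> x < y * Suc q"
    then show "x div y \<le> q"
      by (metis div_by_0 le0 less_Suc_eq_le less_mult_imp_div_less mult.commute)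
  qed
  show ?thesis unfolding eq
    by (intro computable_Least decidable_or decidable_less decidable_eq computable_mult
        computable_Suc computable_const computable_var0 computable_weaken[OF assms(1)]
        computable_weaken[OF assms(2)])
      (auto, metis dividend_less_times_div gr0I mult_Suc_right)
qed

lemma computable_mod:
  assumes "computable_on D n f" "computable_on D n g"
  shows "computable_on D n (\<lambda>p xs. f p xs mod g p xs)"
  by (simp only: modulo_nat_def) (intro computable_diff computable_mult computable_div assms)

lemma decidable_even:
  assumes "computable_on D n f"
  shows "decidable_on D n (\<lambda>p xs. even (f p xs))"
  unfolding even_iff_mod_2_eq_zero by (intro decidable_eq computable_mod computable_const assms)

lemma decidable_iff:
  assumes "decidable_on D n Q" "decidable_on D n Q'"
  shows "decidable_on D n (\<lambda>p xs. Q p xs \<longleftrightarrow> Q' p xs)"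
  using decidable_eq[OF assms] by (simp only: of_bool_eq_iff)

lemma computable_prod_encode:
  assumes "computable_on D n f" "computable_on D n g"
  shows "computable_on D n (\<lambda>p xs. prod_encode (f p xs, g p xs))"
  unfolding prod_encode_def triangle_def split
  by (intro computable_add computable_div computable_mult computable_Suc computable_const assms)

lemma computable_fst_decode:
  assumes "computable_on D n f"
  shows "computable_on D n (\<lambda>p xs. fst (prod_decode (f p xs)))"
proof -
  have eq: "fst (prod_decode c) = (LEAST a. \<exists>b<Suc c. prod_encode (a, b) = c)" for c
  proof -
    obtain a b where ab: "prod_decode c = (a, b)" by fastforce
    then have c: "c = prod_encode (a, b)" by (metis prod_decode_inverse)
    show ?thesis
      by (rule Least_equality[symmetric]) (use le_prod_encode_2[of b a] c in \<open>auto simp: less_Suc_eq_le\<close>)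
  qed
  have "\<exists>a b. b < Suc c \<and> prod_encode (a, b) = c" for c
    by (metis le_imp_less_Suc le_prod_encode_2 prod_decode_inverse surj_pair)
  then show ?thesis unfolding eq
    by (intro computable_Least decidable_bex decidable_eq computable_prod_encode computable_Suc
        computable_var0 computable_var1 computable_weaken[OF assms]
        computable_weaken[OF computable_weaken[OF assms]]) auto
qed

lemma computable_snd_decode:
  assumes "computable_on D n f"
  shows "computable_on D n (\<lambda>p xs. snd (prod_decode (f p xs)))"
proof -
  have eq: "snd (prod_decode c) = (LEAST b. prod_encode (fst (prod_decode c), b) = c)" for c
  proof -
    obtain a b where ab: "prod_decode c = (a, b)" by fastforce
    then have c: "c = prod_encode (a, b)" by (metis prod_decode_inverse)
    show ?thesis by (rule Least_equality[symmetric]) (use c in auto)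
  qed
  have "\<exists>b. prod_encode (fst (prod_decode c), b) = c" for c
    by (metis prod.collapse prod_decode_inverse)
  then show ?thesis unfolding eq
    by (intro computable_Least decidable_eq computable_prod_encode computable_fst_decode
        computable_var0 computable_weaken[OF assms]) auto
qed

text \<open>
  The additional argument in front is the position that is read. The oracle of a nested algorithm
  can thus be any computably presented sequence, such as a column of a decoded double sequence.
\<close>

definition baire_computable_on :: "baire set \<Rightarrow> nat \<Rightarrow> (baire \<Rightarrow> nat list \<Rightarrow> baire) \<Rightarrow> bool" where
  "baire_computable_on D n W \<longleftrightarrow> computable_on D (Suc n) (\<lambda>p ys. W p (tl ys) (hd ys))"

lemma computable_app:
  assumes "baire_computable_on D n W" "computable_on D n f"
  shows "computable_on D n (\<lambda>p xs. W p xs (f p xs))"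
proof -
  obtain ef where ef: "\<And>p xs. p \<in> D \<Longrightarrow> length xs = n \<Longrightarrow> runs p ef xs (f p xs)"
    using assms(2) unfolding computable_on_def by blast
  obtain ew where ew: "\<And>p ys. p \<in> D \<Longrightarrow> length ys = Suc n \<Longrightarrow> runs p ew ys (W p (tl ys) (hd ys))"
    using assms(1) unfolding baire_computable_on_def computable_on_def by blast
  have "runs p (scheme.Comp ew (ef # map Proj [0..<n])) xs (W p xs (f p xs))"
    if "p \<in> D" "length xs = n" for p xs
    by (rule runs.Comp[where ys = "f p xs # xs"])
      (use that ef ew[of p "f p xs # xs"] in \<open>auto simp: nth_Cons' intro: runs.Proj\<close>)
  then show ?thesis unfolding computable_on_def by blast
qed

lemma baire_computable_weaken:
  assumes "baire_computable_on D n W"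
  shows "baire_computable_on D (Suc n) (\<lambda>p ys. W p (tl ys))"
proof -
  obtain ew where ew: "\<And>p ys. p \<in> D \<Longrightarrow> length ys = Suc n \<Longrightarrow> runs p ew ys (W p (tl ys) (hd ys))"
    using assms(1) unfolding baire_computable_on_def computable_on_def by blast
  have "runs p (scheme.Comp ew (Proj 0 # map (\<lambda>i. Proj (Suc (Suc i))) [0..<n])) ys
      (W p (tl (tl ys)) (hd ys))"
    if "p \<in> D" "length ys = Suc (Suc n)" for p ys
  proof -
    obtain x y zs where ys: "ys = x # y # zs" "length zs = n"
      using \<open>length ys = Suc (Suc n)\<close> by (auto simp: length_Suc_conv)
    have proj: "runs p (Proj 0) ys x" "\<And>i. i < n \<Longrightarrow> runs p (Proj (Suc (Suc i))) ys (zs ! i)"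
      using runs.Proj[of 0 ys] runs.Proj[of "Suc (Suc _)" ys] ys by auto
    show ?thesis
      by (rule runs.Comp[where ys = "x # zs"])
        (use that ys proj ew[of p "x # zs"] in \<open>auto simp: less_Suc_eq_0_disj\<close>)
  qed
  then show ?thesis unfolding baire_computable_on_def computable_on_def by blast
qed

lemma computable_query:
  assumes "computable_on D n f"
  shows "computable_on D n (\<lambda>p xs. p (f p xs))"
proof -
  obtain d where d: "\<And>p xs. p \<in> D \<Longrightarrow> length xs = n \<Longrightarrow> runs p d xs (f p xs)"
    using assms unfolding computable_on_def by blast
  have "runs p (scheme.Comp Query [d]) xs (p (f p xs))" if "p \<in> D" "length xs = n" for p xs
    by (rule runs.Comp[where ys = "[f p xs]"]) (use that d in \<open>auto intro: runs.Query\<close>)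
  then show ?thesis unfolding computable_on_def by blast
qed

lemmas computable_intros = 
  computable_add computable_diff computable_mult computable_power computable_div computable_mod
  computable_Suc computable_if computable_prod_encode computable_fst_decode computable_snd_decode
  decidable_less decidable_le decidable_eq decidable_not decidable_and decidable_or decidable_imp
  decidable_iff decidable_even decidable_bex decidable_ball
  computable_var0 computable_var1 computable_var2 computable_const

section \<open>Finite use of the oracle\<close>

text \<open>
  A halting computation asks only finitely many questions. In a composition and in a minimisation the
  sum of the bounds of the parts dominates each of them.
\<close>

lemma runs_use:
  assumes "runs p e xs y"
  shows "\<exists>m. \<forall>p'. (\<forall>i<m. p' i = p i) \<longrightarrow> runs p' e xs y"
  using assms
proof (induction rule: runs.induct)
  case (Query x)
  show ?case by (rule exI[of _ "Suc x"]) (metis lessI runs.Query)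
next
  case (Comp ys gs xs f y)
  then have "\<forall>i. \<exists>m. i < length gs \<longrightarrow> (\<forall>p'. (\<forall>j<m. p' j = p j) \<longrightarrow> runs p' (gs ! i) xs (ys ! i))"
    by metis
  then obtain m where m: "\<And>i p'. i < length gs \<Longrightarrow> \<forall>j<m i. p' j = p j \<Longrightarrow> runs p' (gs ! i) xs (ys ! i)"
    by metis
  obtain m' where m': "\<And>p'. \<forall>j<m'. p' j = p j \<Longrightarrow> runs p' f ys y" using Comp by blast
  show ?case
  proof (intro exI[of _ "m' + (\<Sum>i<length gs. m i)"] allI impI)
    fix p' assume p': "\<forall>i<m' + (\<Sum>i<length gs. m i). p' i = p i"
    have "m i \<le> (\<Sum>i<length gs. m i)" if "i < length gs" for i
      by (rule member_le_sum) (use that in auto)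
    with p' have "\<forall>i<length gs. runs p' (gs ! i) xs (ys ! i)"
      by (intro allI impI m) (auto intro: order_less_le_trans trans_le_add2)
    with m'[of p'] p' Comp(1) show "runs p' (scheme.Comp f gs) xs y"
      by (intro runs.Comp) auto
  qed
next
  case (PrimRec_0 f xs y g)
  then show ?case by (meson runs.PrimRec_0)
next
  case (PrimRec_Suc f g n xs r y)
  then obtain m1 m2 where "\<forall>p'. (\<forall>i<m1. p' i = p i) \<longrightarrow> runs p' (PrimRec f g) (n # xs) r"
    "\<forall>p'. (\<forall>i<m2. p' i = p i) \<longrightarrow> runs p' g (n # r # xs) y" by blast
  then show ?case
    by (intro exI[of _ "max m1 m2"]) (auto intro!: runs.PrimRec_Suc[where r = r])
next
  case (Minim f n xs)
  then have "\<forall>i. \<exists>m y. i < n \<longrightarrow> (\<forall>p'. (\<forall>j<m. p' j = p j) \<longrightarrow> runs p' f (i # xs) (Suc y))"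
    by metis
  then obtain m z where m: "\<And>i p'. i < n \<Longrightarrow> \<forall>j<m i. p' j = p j \<Longrightarrow> runs p' f (i # xs) (Suc (z i))"
    by metis
  obtain m' where m': "\<And>p'. \<forall>j<m'. p' j = p j \<Longrightarrow> runs p' f (n # xs) 0" using Minim by blast
  show ?case
  proof (intro exI[of _ "m' + (\<Sum>i<n. m i)"] allI impI)
    fix p' assume p': "\<forall>i<m' + (\<Sum>i<n. m i). p' i = p i"
    have "m i \<le> (\<Sum>i<n. m i)" if "i < n" for i
      by (rule member_le_sum) (use that in auto)
    with p' have "\<forall>i<n. runs p' f (i # xs) (Suc (z i))"
      by (intro allI impI m) (auto intro: order_less_le_trans trans_le_add2)
    with m'[of p'] p' show "runs p' (Minim f) xs n"
      by (intro runs.Minim) auto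
  qed
qed (metis runs.intros)+

section \<open>Rational-valued computable functions\<close>

text \<open>
  A difference of naturals over a positive natural: sums, products and comparisons need no case
  distinction on signs.
\<close>

definition rational_computable_on ::
    "baire set \<Rightarrow> nat \<Rightarrow> (baire \<Rightarrow> nat list \<Rightarrow> real) \<Rightarrow> bool" where
  "rational_computable_on D n f \<longleftrightarrow> (\<exists>a b c. computable_on D n a \<and> computable_on D n b \<and>
    computable_on D n c \<and> (\<forall>p\<in>D. \<forall>xs. length xs = n \<longrightarrow>
      f p xs = (real (a p xs) - real (b p xs)) / real (Suc (c p xs))))"

lemma rational_computableI:
  assumes "computable_on D n a" "computable_on D n b" "computable_on D n c"
    and "\<And>p xs. p \<in> D \<Longrightarrow> length xs = n \<Longrightarrow>
      f p xs = (real (a p xs) - real (b p xs)) / real (Suc (c p xs))"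
  shows "rational_computable_on D n f"
  unfolding rational_computable_on_def using assms by blast

lemma rational_computableE:
  assumes "rational_computable_on D n f"
  obtains a b c where "computable_on D n a" "computable_on D n b" "computable_on D n c"
    "\<And>p xs. p \<in> D \<Longrightarrow> length xs = n \<Longrightarrow>
      f p xs = (real (a p xs) - real (b p xs)) / real (Suc (c p xs))"
  using assms unfolding rational_computable_on_def by blast

lemma rational_of_nat: "computable_on D n f \<Longrightarrow> rational_computable_on D n (\<lambda>p xs. real (f p xs))"
  by (rule rational_computableI[where b = "\<lambda>_ _. 0" and c = "\<lambda>_ _. 0"])
    (auto intro: computable_const)

lemma rational_numeral: "rational_computable_on D n (\<lambda>p xs. numeral k)"
  using rational_of_nat[OF computable_const[of D n "numeral k"]] by simp

lemma rational_0: "rational_computable_on D n (\<lambda>p xs. 0)"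
  using rational_of_nat[OF computable_const[of D n 0]] by simp

lemma rational_1: "rational_computable_on D n (\<lambda>p xs. 1)"
  using rational_of_nat[OF computable_const[of D n 1]] by simp

lemma rational_power:
  "computable_on D n f \<Longrightarrow> rational_computable_on D n (\<lambda>p xs. numeral k ^ f p xs)"
  using rational_of_nat[OF computable_power[OF computable_const[of D n "numeral k"]]] by simp

lemma rational_weaken:
  assumes "rational_computable_on D n f"
  shows "rational_computable_on D (Suc n) (\<lambda>p ys. f p (tl ys))"
proof -
  obtain a b c where "computable_on D n a" "computable_on D n b" "computable_on D n c"
    "\<And>p xs. p \<in> D \<Longrightarrow> length xs = n \<Longrightarrow>
      f p xs = (real (a p xs) - real (b p xs)) / real (Suc (c p xs))"
    using rational_computableE[OF assms] by blast
  then show ?thesis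
    by (intro rational_computableI[OF computable_weaken computable_weaken computable_weaken]) auto
qed

lemma rational_add:
  assumes "rational_computable_on D n f" "rational_computable_on D n g"
  shows "rational_computable_on D n (\<lambda>p xs. f p xs + g p xs)"
proof -
  obtain a b c where f: "computable_on D n a" "computable_on D n b" "computable_on D n c"
    "\<And>p xs. p \<in> D \<Longrightarrow> length xs = n \<Longrightarrow>
      f p xs = (real (a p xs) - real (b p xs)) / real (Suc (c p xs))"
    using rational_computableE[OF assms(1)] by blast
  obtain a' b' c' where g: "computable_on D n a'" "computable_on D n b'" "computable_on D n c'"
    "\<And>p xs. p \<in> D \<Longrightarrow> length xs = n \<Longrightarrow>
      g p xs = (real (a' p xs) - real (b' p xs)) / real (Suc (c' p xs))"
    using rational_computableE[OF assms(2)] by blast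
  have eq: "(real x - real y) / real (Suc z) + (real x' - real y') / real (Suc z') =
      (real (x * Suc z' + x' * Suc z) - real (y * Suc z' + y' * Suc z)) /
      real (Suc (Suc z * Suc z' - 1))" for x y z x' y' z'
  proof -
    have "Suc (Suc z * Suc z' - 1) = Suc z * Suc z'" by simp
    then show ?thesis
      by (simp only: of_nat_mult of_nat_add) (simp add: add_frac_eq algebra_simps del: of_nat_Suc)
  qed
  show ?thesis
    by (rule rational_computableI[
          where a = "\<lambda>p xs. a p xs * Suc (c' p xs) + a' p xs * Suc (c p xs)"
          and b = "\<lambda>p xs. b p xs * Suc (c' p xs) + b' p xs * Suc (c p xs)"
          and c = "\<lambda>p xs. Suc (c p xs) * Suc (c' p xs) - 1"])
      (use f g eq in \<open>auto intro!: computable_intros simp del: of_nat_Suc mult_Suc mult_Suc_right\<close>)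
qed

lemma rational_mult:
  assumes "rational_computable_on D n f" "rational_computable_on D n g"
  shows "rational_computable_on D n (\<lambda>p xs. f p xs * g p xs)"
proof -
  obtain a b c where f: "computable_on D n a" "computable_on D n b" "computable_on D n c"
    "\<And>p xs. p \<in> D \<Longrightarrow> length xs = n \<Longrightarrow>
      f p xs = (real (a p xs) - real (b p xs)) / real (Suc (c p xs))"
    using rational_computableE[OF assms(1)] by blast
  obtain a' b' c' where g: "computable_on D n a'" "computable_on D n b'" "computable_on D n c'"
    "\<And>p xs. p \<in> D \<Longrightarrow> length xs = n \<Longrightarrow>
      g p xs = (real (a' p xs) - real (b' p xs)) / real (Suc (c' p xs))"
    using rational_computableE[OF assms(2)] by blast
  have eq: "(real x - real y) / real (Suc z) * ((real x' - real y') / real (Suc z')) =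
      (real (x * x' + y * y') - real (x * y' + y * x')) / real (Suc (Suc z * Suc z' - 1))"
    for x y z x' y' z'
  proof -
    have "Suc (Suc z * Suc z' - 1) = Suc z * Suc z'" by simp
    then show ?thesis
      by (simp only: of_nat_mult of_nat_add times_divide_times_eq) (simp add: algebra_simps del: of_nat_Suc)
  qed
  show ?thesis
    by (rule rational_computableI[where a = "\<lambda>p xs. a p xs * a' p xs + b p xs * b' p xs"
          and b = "\<lambda>p xs. a p xs * b' p xs + b p xs * a' p xs"
          and c = "\<lambda>p xs. Suc (c p xs) * Suc (c' p xs) - 1"])
      (use f g eq in \<open>auto intro!: computable_intros simp del: of_nat_Suc mult_Suc mult_Suc_right\<close>)
qed

lemma rational_minus:
  assumes "rational_computable_on D n f"
  shows "rational_computable_on D n (\<lambda>p xs. - f p xs)"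
proof -
  obtain a b c where "computable_on D n a" "computable_on D n b" "computable_on D n c"
    "\<And>p xs. p \<in> D \<Longrightarrow> length xs = n \<Longrightarrow>
      f p xs = (real (a p xs) - real (b p xs)) / real (Suc (c p xs))"
    using rational_computableE[OF assms] by blast
  then show ?thesis
    by (intro rational_computableI[where a = b and b = a and c = c]) (auto simp: field_simps)
qed

lemma rational_diff:
  assumes "rational_computable_on D n f" "rational_computable_on D n g"
  shows "rational_computable_on D n (\<lambda>p xs. f p xs - g p xs)"
  using rational_add[OF assms(1) rational_minus[OF assms(2)]] by simp

lemma rational_inverse:
  assumes "rational_computable_on D n f"
  shows "rational_computable_on D n (\<lambda>p xs. inverse (f p xs))"
proof -
  obtain a b c where f: "computable_on D n a" "computable_on D n b" "computable_on D n c"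
    "\<And>p xs. p \<in> D \<Longrightarrow> length xs = n \<Longrightarrow>
      f p xs = (real (a p xs) - real (b p xs)) / real (Suc (c p xs))"
    using rational_computableE[OF assms] by blast
  have eq: "inverse ((real x - real y) / real (Suc z)) =
      (real (if y < x then Suc z else 0) - real (if x < y then Suc z else 0)) /
      real (Suc ((x - y) + (y - x) - 1))" for x y z
  proof (cases x y rule: linorder_cases)
    case less
    then have "real (Suc ((x - y) + (y - x) - 1)) = real y - real x"
      by (simp add: of_nat_diff Suc_diff_Suc)
    with less show ?thesis by (simp add: divide_simps algebra_simps)
  next
    case greater
    then have "real (Suc ((x - y) + (y - x) - 1)) = real x - real y"
      by (simp add: of_nat_diff Suc_diff_Suc)
    with greater show ?thesis by (simp add: divide_simps algebra_simps)
  qed simp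
  show ?thesis
    by (rule rational_computableI[where a = "\<lambda>p xs. if b p xs < a p xs then Suc (c p xs) else 0"
          and b = "\<lambda>p xs. if a p xs < b p xs then Suc (c p xs) else 0"
          and c = "\<lambda>p xs. (a p xs - b p xs) + (b p xs - a p xs) - 1"])
      (use f eq in \<open>auto intro!: computable_intros\<close>)
qed

lemma rational_divide:
  assumes "rational_computable_on D n f" "rational_computable_on D n g"
  shows "rational_computable_on D n (\<lambda>p xs. f p xs / g p xs)"
  using rational_mult[OF assms(1) rational_inverse[OF assms(2)]] by (simp add: divide_inverse)

lemma rational_if:
  assumes "decidable_on D n Q" "rational_computable_on D n f" "rational_computable_on D n g"
  shows "rational_computable_on D n (\<lambda>p xs. if Q p xs then f p xs else g p xs)"
proof -
  have "(if b then x else y) = real (of_bool b) * x + (1 - real (of_bool b)) * y" for b and x y :: real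
    by auto
  then show ?thesis
    by (simp only:) (intro rational_add rational_mult rational_diff rational_of_nat rational_1 assms)
qed

lemma computable_floor:
  assumes "rational_computable_on D n f"
  shows "computable_on D n (\<lambda>p xs. nat \<lfloor>f p xs\<rfloor>)"
proof -
  obtain a b c where f: "computable_on D n a" "computable_on D n b" "computable_on D n c"
    "\<And>p xs. p \<in> D \<Longrightarrow> length xs = n \<Longrightarrow>
      f p xs = (real (a p xs) - real (b p xs)) / real (Suc (c p xs))"
    using rational_computableE[OF assms] by blast
  have eq: "nat \<lfloor>(real x - real y) / real (Suc z)\<rfloor> = (x - y) div Suc z" for x y z
  proof (cases "y \<le> x")
    case True
    have "nat \<lfloor>real (x - y) / real (Suc z)\<rfloor> = (x - y) div Suc z"
      by (simp only: floor_divide_of_nat_eq nat_int)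
    with True show ?thesis by (simp add: of_nat_diff)
  next
    case False
    then have "(real x - real y) / real (Suc z) < 0" by (simp add: divide_neg_pos)
    with False show ?thesis by simp
  qed
  show ?thesis
    by (rule computable_cong[where f = "\<lambda>p xs. (a p xs - b p xs) div Suc (c p xs)"])
      (use f eq in \<open>auto intro!: computable_intros simp del: of_nat_Suc\<close>)
qed

lemma rational_less:
  assumes "rational_computable_on D n f" "rational_computable_on D n g"
  shows "decidable_on D n (\<lambda>p xs. f p xs < g p xs)"
proof -
  obtain a b c where d: "computable_on D n a" "computable_on D n b" "computable_on D n c"
    "\<And>p xs. p \<in> D \<Longrightarrow> length xs = n \<Longrightarrow>
      g p xs - f p xs = (real (a p xs) - real (b p xs)) / real (Suc (c p xs))"
    using rational_computableE[OF rational_diff[OF assms(2,1)]] by blast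
  have eq: "0 < (real x - real y) / real (Suc z) \<longleftrightarrow> y < x" for x y z
    by (simp add: zero_less_divide_iff)
  have "f p xs < g p xs \<longleftrightarrow> b p xs < a p xs" if "p \<in> D" "length xs = n" for p xs
    using d(4)[OF that] eq by (metis diff_gt_0_iff_gt)
  then show ?thesis
    by (intro computable_cong[OF decidable_less[OF d(2,1)]]) auto
qed

lemma rational_le:
  assumes "rational_computable_on D n f" "rational_computable_on D n g"
  shows "decidable_on D n (\<lambda>p xs. f p xs \<le> g p xs)"
  using decidable_not[OF rational_less[OF assms(2,1)]] by (simp add: not_less)

abbreviation rat_of_code :: "nat \<Rightarrow> real" where
  "rat_of_code c \<equiv> of_rat (nat_to_rat_surj c)"

lemma int_decode_eq: "int_decode c = (if even c then int ((c + 1) div 2) else - int ((c + 1) div 2))"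
  by (auto simp: int_decode_def sum_decode_def elim!: evenE oddE)

text \<open>
  Both components of a rational code are signed integers, with the sign in the parity of
  the code and the absolute value equal to half of the code, rounded up.
\<close>

lemma rational_rat_of_code:
  assumes "computable_on D n f"
  shows "rational_computable_on D n (\<lambda>p xs. rat_of_code (f p xs))"
proof -
  have eq: "rat_of_code c =
    (let x = fst (prod_decode c); y = snd (prod_decode c) in
      real ((x + 1) div 2) / real ((y + 1) div 2) * (if even x \<longleftrightarrow> even y then 1 else - 1))" for c
  proof -
    have fract: "real_of_rat (Fract a b) = of_int a / of_int b" for a b
      by (cases "b = 0") (simp_all add: of_rat_rat rat_number_collapse)
    have signs: "(if P then u else - u) / (if Q then v else - v) =
        u / v * (if P \<longleftrightarrow> Q then 1 else - 1)" for P Q and u v :: real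
      by auto
    have decode: "real_of_int (int_decode x) =
        (if even x then real ((x + 1) div 2) else - real ((x + 1) div 2))" for x
      unfolding int_decode_eq by simp
    show ?thesis
      by (simp only: nat_to_rat_surj_def Let_def split_beta fract decode signs)
  qed
  show ?thesis unfolding eq Let_def
    by (intro rational_mult rational_divide rational_if rational_of_nat rational_1 rational_minus
        computable_intros assms)
qed

lemmas rational_intros = rational_add rational_diff rational_mult rational_divide rational_minus
  rational_if rational_power rational_of_nat rational_numeral rational_0 rational_1
  rational_rat_of_code rational_less rational_le

section \<open>Polygonal functions\<close>

text \<open>
  The code of the list of nodes without its first node, which is itself the code of the empty list if the
  given list has at most one node.
\<close>

definition tail_code :: "nat \<Rightarrow> nat" where
  "tail_code L = snd (prod_decode (L - 1))"

definition abscissa :: "nat \<Rightarrow> real" where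
  "abscissa L = rat_of_code (fst (prod_decode (fst (prod_decode (L - 1)))))"

definition ordinate :: "nat \<Rightarrow> real" where
  "ordinate L = rat_of_code (snd (prod_decode (fst (prod_decode (L - 1)))))"

lemma tail_code_less: "0 < L \<Longrightarrow> tail_code L < L"
  unfolding tail_code_def
  by (metis Suc_pred' le_imp_less_Suc le_prod_encode_2 prod.collapse prod_decode_inverse)

lemma tail_code_0 [simp]: "tail_code 0 = 0"
  by (simp add: tail_code_def prod_decode_def prod_decode_aux.simps[of 0 0])

lemma nodes_of_code_0: "nodes_of_code 0 = []"
  by (simp add: nodes_of_code_def)

lemma nodes_of_code_pos:
  assumes "0 < L"
  obtains a c where "nodes_of_code L = (a, c) # nodes_of_code (tail_code L)"
    "abscissa L = of_rat a" "ordinate L = of_rat c"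
proof (rule that)
  let ?node = "prod_decode (fst (prod_decode (L - 1)))"
  show "nodes_of_code L =
      (nat_to_rat_surj (fst ?node), nat_to_rat_surj (snd ?node)) # nodes_of_code (tail_code L)"
    using assms by (cases L) (auto simp: nodes_of_code_def tail_code_def map_prod_def split_beta)
qed (simp_all add: abscissa_def ordinate_def)

text \<open>
  The recursion of \<^const>\<open>polygonal\<close> at \<open>x\<close> makes no further call on the list coded by \<open>L\<close>.
\<close>

definition settled :: "real \<Rightarrow> nat \<Rightarrow> bool" where
  "settled x L \<longleftrightarrow> tail_code L = 0 \<or> x \<le> abscissa (tail_code L)"

definition advance :: "real \<Rightarrow> nat \<Rightarrow> nat" where
  "advance x L = (if settled x L then L else tail_code L)"

lemma advance_settled: "settled x L \<Longrightarrow> advance x L = L"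
  and advance_unsettled: "\<not> settled x L \<Longrightarrow> advance x L = tail_code L"
  by (simp_all add: advance_def)

lemma polygonal_advance:
  "polygonal (nodes_of_code (advance x L)) x = polygonal (nodes_of_code L) x"
proof (cases "settled x L")
  case False
  then have t: "0 < tail_code L" "\<not> x \<le> abscissa (tail_code L)" by (auto simp: settled_def)
  then have "0 < L" by (auto intro!: gr0I)
  obtain a c where 1: "nodes_of_code L = (a, c) # nodes_of_code (tail_code L)"
    using nodes_of_code_pos[OF \<open>0 < L\<close>] by metis
  obtain b d where 2: "nodes_of_code (tail_code L) = (b, d) # nodes_of_code (tail_code (tail_code L))"
      "abscissa (tail_code L) = of_rat b"
    using nodes_of_code_pos[OF t(1)] by metis
  show ?thesis using False t by (simp add: advance_def 1 2)
qed (simp add: advance_def)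

text \<open>
  Each unsettled step decreases the code, so the code itself is a sufficient number of steps.
\<close>

lemma settled_iterate: "settled x (rec_nat L (\<lambda>_. advance x) L)"
proof -
  have "settled x (rec_nat L (\<lambda>_. advance x) k) \<or> rec_nat L (\<lambda>_. advance x) k + k \<le> L" for k
  proof (induction k)
    case (Suc k)
    let ?M = "rec_nat L (\<lambda>_. advance x) k"
    show ?case
    proof (cases "settled x ?M")
      case False
      then have "0 < ?M" by (auto simp: settled_def intro!: gr0I)
      with False Suc tail_code_less[of ?M] show ?thesis by (simp add: advance_unsettled)
    next
      case True
      then show ?thesis by (simp add: advance_settled)
    qed
  qed simp
  from this[of L] show ?thesis by (auto simp: settled_def)
qed

lemma polygonal_settled:
  assumes "settled x L"
  shows "polygonal (nodes_of_code L) x =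
    (if L = 0 then 0 else if tail_code L = 0 then ordinate L
     else ordinate L + (x - abscissa L) * (ordinate (tail_code L) - ordinate L) /
       (abscissa (tail_code L) - abscissa L))"
proof (cases "L = 0")
  case False
  then obtain a c where 1: "nodes_of_code L = (a, c) # nodes_of_code (tail_code L)"
    "abscissa L = of_rat a" "ordinate L = of_rat c"
    using nodes_of_code_pos[of L] by auto
  show ?thesis
  proof (cases "tail_code L = 0")
    case True
    with False 1 show ?thesis by (simp add: nodes_of_code_0)
  next
    case nz: False
    then obtain b d where 2: "nodes_of_code (tail_code L) = (b, d) # nodes_of_code (tail_code (tail_code L))"
      "abscissa (tail_code L) = of_rat b" "ordinate (tail_code L) = of_rat d"
      using nodes_of_code_pos[of "tail_code L"] by auto
    show ?thesis using assms False nz unfolding settled_def by (simp add: 1 2)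
  qed
qed (simp add: nodes_of_code_0)

text \<open>
  The recursion along the list of nodes as an iteration on codes, which is the form in which
  \<open>computable_rec\<close> applies.
\<close>

lemma polygonal_eq:
  "polygonal (nodes_of_code L) x =
    (let M = rec_nat L (\<lambda>_. advance x) L in
     if M = 0 then 0 else if tail_code M = 0 then ordinate M
     else ordinate M + (x - abscissa M) * (ordinate (tail_code M) - ordinate M) /
       (abscissa (tail_code M) - abscissa M))"
proof -
  have "polygonal (nodes_of_code (rec_nat L (\<lambda>_. advance x) k)) x = polygonal (nodes_of_code L) x" for k
    by (induction k) (simp_all add: polygonal_advance)
  from this[of L] polygonal_settled[OF settled_iterate] show ?thesis
    by (simp add: Let_def)
qed

lemma rational_polygonal:
  assumes "computable_on D n L" "rational_computable_on D n x"
  shows "rational_computable_on D n (\<lambda>p xs. polygonal (nodes_of_code (L p xs)) (x p xs))"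
proof -
  have tail: "computable_on D n (\<lambda>p xs. tail_code (f p xs))" if "computable_on D n f" for n f
    unfolding tail_code_def by (intro computable_intros that)
  have abscissa: "rational_computable_on D n (\<lambda>p xs. abscissa (f p xs))" if "computable_on D n f" for n f
    unfolding abscissa_def by (intro rational_intros computable_intros that)
  have ordinate: "rational_computable_on D n (\<lambda>p xs. ordinate (f p xs))" if "computable_on D n f" for n f
    unfolding ordinate_def by (intro rational_intros computable_intros that)
  have iterate: "computable_on D n (\<lambda>p xs. rec_nat (L p xs) (\<lambda>k r. advance (x p xs) r) (L p xs))"
    unfolding advance_def settled_def
    by (intro computable_rec rational_intros computable_intros tail abscissa assms
        rational_weaken[OF rational_weaken[OF assms(2)]]) simp_all
  show ?thesis unfolding polygonal_eq Let_def
    by (intro rational_intros computable_intros tail abscissa ordinate iterate assms)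
qed

section \<open>Approximating the answer\<close>

lemma tau_summable: "summable (\<lambda>n. 2 * of_bool (b n) / 3 ^ (n + 1) :: real)"
proof (rule summable_comparison_test')
  show "summable (\<lambda>n. (1 / 3 :: real) ^ n)" by (rule summable_geometric) simp
  show "norm (2 * of_bool (b n) / 3 ^ (n + 1) :: real) \<le> (1 / 3) ^ n" for n
    by (simp add: power_divide divide_simps)
qed

text \<open>
  The integers \<open>3 ^ j\<close> times the partial sums of \<^const>\<open>tau\<close>.
\<close>

primrec tau_numerator :: "cantor \<Rightarrow> nat \<Rightarrow> nat" where
  "tau_numerator b 0 = 0"
| "tau_numerator b (Suc j) = 3 * tau_numerator b j + 2 * of_bool (b j)"

lemma tau_split: "tau b = tau_numerator b j / 3 ^ j + tau (\<lambda>n. b (n + j)) / 3 ^ j"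
proof -
  have "(\<Sum>n<j. 2 * of_bool (b n) / 3 ^ (n + 1)) = real (tau_numerator b j) / 3 ^ j"
    by (induction j) (simp_all add: add_divide_distrib)
  moreover have "(\<Sum>n. 2 * of_bool (b (n + j)) / 3 ^ (n + j + 1)) = tau (\<lambda>n. b (n + j)) / (3 ^ j :: real)"
    unfolding tau_def
    by (subst suminf_divide[OF tau_summable, symmetric]) (simp add: power_add field_simps)
  ultimately show ?thesis
    using suminf_split_initial_segment[OF tau_summable[of b], of j] unfolding tau_def by simp
qed

lemma tau_tail: "0 \<le> tau b - tau_numerator b j / 3 ^ j" "tau b - tau_numerator b j / 3 ^ j \<le> 1 / 3 ^ j"
  using tau_bounds[of "\<lambda>n. b (n + j)"] tau_split[of b j] by (simp_all add: divide_right_mono)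

text \<open>
  The numerator and the denominator are written out instead of chosen among all codes of the
  rational number, because limits are taken of codes: equal values of \<open>c\<close> have to give equal codes.
\<close>

definition answer :: "cantor \<Rightarrow> nat \<Rightarrow> nat \<Rightarrow> nat" where
  "answer b j c = prod_encode (2 * (2 * 6 ^ j + tau_numerator b j * 2 ^ j + 2 * 3 ^ j * c), 2 * (8 * 6 ^ j))"

lemma rat_of_code_even:
  assumes "0 < d"
  shows "rat_of_code (prod_encode (2 * a, 2 * d)) = real a / real d"
  using assms by (simp add: nat_to_rat_surj_def int_decode_eq of_rat_rat)

lemma rat_of_code_answer:
  "rat_of_code (answer b j c) = 1/4 + 1/8 * (tau_numerator b j / 3 ^ j) + ell * (c / 2 ^ j)"
proof -
  have "(6::real) ^ j = 3 ^ j * 2 ^ j" by (simp flip: power_mult_distrib)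
  then show ?thesis
    unfolding answer_def by (subst rat_of_code_even) (simp_all add: ell_def field_simps)
qed

text \<open>
  The tail of \<^const>\<open>tau\<close> contributes at most \<open>1 / (8 * 3 ^ j)\<close> to the error and the approximation of \<open>z\<close>
  at most \<open>ell\<close> times \<open>2 / 2 ^ j\<close>, which leaves room for the factor \<open>2\<close> in the hypothesis.
\<close>

lemma rho_answer:
  assumes "\<And>j. \<bar>c j / 2 ^ j - z\<bar> \<le> 2 / 2 ^ j"
  shows "rho (\<lambda>j. answer b j (c j)) = Some (shift b + ell * z)"
  unfolding rho_eq_Some_iff cauchy_names_def
proof
  fix j
  define x y u where "x = c j / 2 ^ j - z" and "y = tau b - tau_numerator b j / 3 ^ j"
    and "u = (1 / 2 :: real) ^ j"
  have "1 / 3 ^ j \<le> (1 / 2 ^ j :: real)" by (intro divide_left_mono power_mono) simp_all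
  then have "\<bar>x\<bar> \<le> 2 * u" "0 \<le> y" "y \<le> u"
    using assms[of j] tau_tail[of b j] unfolding x_def y_def u_def by (simp_all add: power_divide)
  moreover have "rat_of_code (answer b j (c j)) - (shift b + ell * z) =
      1/4 * x - 1/8 * y"
    by (simp add: rat_of_code_answer shift_def ell_def x_def y_def algebra_simps)
  ultimately show "\<bar>rat_of_code (answer b j (c j)) - (shift b + ell * z)\<bar> \<le> (1 / 2) ^ j"
    unfolding u_def[symmetric] by linarith
qed

lemma computable_answer:
  assumes "computable_on D n j" "computable_on D n c"
    and b: "\<And>n f. computable_on D n f \<Longrightarrow> decidable_on D n (\<lambda>p xs. B p (f p xs))"
  shows "computable_on D n (\<lambda>p xs. answer (B p) (j p xs) (c p xs))"
proof -
  have eq: "tau_numerator b j = rec_nat 0 (\<lambda>i t. 3 * t + 2 * of_bool (b i)) j" for b j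
    by (induction j) simp_all
  show ?thesis unfolding answer_def eq
    by (intro computable_intros computable_rec assms) simp_all
qed

section \<open>Bisection\<close>

text \<open>
  \<open>N k m\<close> stands for "\<open>k / 2 ^ m\<close> is to the left of the target"; the interval at
  level \<open>j\<close> runs from \<open>bisect N j / 2 ^ j\<close> to its right neighbour.
\<close>

primrec bisect :: "(nat \<Rightarrow> nat \<Rightarrow> bool) \<Rightarrow> nat \<Rightarrow> nat" where
  "bisect N 0 = 0"
| "bisect N (Suc j) = 2 * bisect N j + of_bool (N (2 * bisect N j + 1) (Suc j))"

lemma bisect_less: "bisect N j < 2 ^ j"
  by (induction j) auto

text \<open>
  A level of the bisection asks finitely many questions, so limits of answers become limits of
  positions.
\<close>

lemma eventually_bisect:
  assumes "\<And>k m. k < 2 ^ m \<Longrightarrow> eventually (\<lambda>s. N s k m = M k m) F"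
  shows "eventually (\<lambda>s. bisect (N s) j = bisect M j) F"
proof (induction j)
  case (Suc j)
  have "2 * bisect M j + 1 < 2 ^ Suc j" using bisect_less[of M j] by simp
  from Suc assms[OF this] show ?case by eventually_elim simp
qed simp

lemma bisect_bracket:
  assumes "\<And>k m. M k m \<longleftrightarrow> P (real k / 2 ^ m)" "P 0" "\<not> P 1"
  shows "P (bisect M j / 2 ^ j) \<and> \<not> P ((bisect M j + 1) / 2 ^ j)"
proof (induction j)
  case (Suc j)
  have "(2 * real c) / 2 ^ Suc j = real c / 2 ^ j" "(2 * real c + 1 + 1) / 2 ^ Suc j = (real c + 1) / 2 ^ j"
    for c by (simp_all add: field_simps)
  with Suc show ?case
    using assms(1)[of "2 * bisect M j + 1" "Suc j"] by (auto simp: add.commute)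
qed (use assms in simp)

text \<open>
  The oracle of the test, a stage and the dyadic point \<open>k / 2 ^ m\<close> may all depend computably on the
  context. The oracle \<open>W p xs\<close> is needed for columns, whose index is a variable.
\<close>

definition computable_test :: "(baire \<Rightarrow> nat \<Rightarrow> nat \<Rightarrow> nat \<Rightarrow> bool) \<Rightarrow> bool" where
  "computable_test N \<longleftrightarrow> (\<forall>D n W s k m. baire_computable_on D n W \<longrightarrow> computable_on D n s \<longrightarrow>
    computable_on D n k \<longrightarrow> computable_on D n m \<longrightarrow>
    decidable_on D n (\<lambda>p xs. N (W p xs) (s p xs) (k p xs) (m p xs)))"

lemma computable_bisect:
  assumes "computable_test N" "baire_computable_on D n W" "computable_on D n s" "computable_on D n j"
  shows "computable_on D n (\<lambda>p xs. bisect (N (W p xs) (s p xs)) (j p xs))"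
proof -
  have eq: "bisect M j = rec_nat 0 (\<lambda>i c. 2 * c + of_bool (M (2 * c + 1) (Suc i))) j" for M j
    by (induction j) simp_all
  show ?thesis unfolding eq
    by (intro computable_rec computable_intros assms(1)[unfolded computable_test_def, rule_format]
        baire_computable_weaken[OF baire_computable_weaken[OF assms(2)]] assms(4)
        computable_weaken[OF computable_weaken[OF assms(3)]]) simp_all
qed

section \<open>Decoding the evaluation table\<close>

definition table_names :: "baire set" where
  "table_names = {p. \<exists>w b. product_cauchy_name p (\<lambda>n. evaluations n (w, b))}"

definition table_bit :: "baire \<Rightarrow> nat \<Rightarrow> bool" where
  "table_bit p n \<longleftrightarrow> 1 / 2 < rat_of_code (p (prod_encode (Suc n, 2)))"

text \<open>
  The precision \<open>2 * n + 3\<close> makes the error of the scaled approximation smaller than \<open>1 / 2\<close>, because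
  \<open>3 ^ (n + 1) / 2 ^ (2 * n + 3) = (3 / 4) ^ (n + 1) / 2\<close>.
\<close>

definition table_digit :: "baire \<Rightarrow> nat \<Rightarrow> bool" where
  "table_digit p n \<longleftrightarrow>
    2 \<le> nat \<lfloor>3 ^ Suc n * rat_of_code (p (prod_encode (0, 2 * n + 3))) + 1 / 2\<rfloor> mod 6"

definition next_digit :: "baire \<Rightarrow> nat \<Rightarrow> nat" where
  "next_digit p x = (LEAST y. x \<le> y \<and> table_digit p y)"

primrec table_block :: "baire \<Rightarrow> nat \<Rightarrow> nat" where
  "table_block p 0 = 0"
| "table_block p (Suc i) = Suc (next_digit p (table_block p i))"

definition table_point :: "baire \<Rightarrow> nat \<Rightarrow> nat" where
  "table_point p i = next_digit p (table_block p i) - table_block p i"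

lemma even_tau_numerator: "even (tau_numerator b j)"
  by (induction j) auto

text \<open>
  All digits are even, hence so is the integer formed by the first \<open>n\<close> of them, and
  \<open>3 ^ (n + 1) * tau b\<close> is a multiple of \<open>6\<close> plus \<open>0\<close> or \<open>2\<close> plus a tail in the unit interval. After
  adding \<open>1 / 2\<close> to the approximation the residue modulo \<open>6\<close> is \<open>0\<close> or \<open>1\<close> in the first
  case and \<open>2\<close> or \<open>3\<close> in the second, so the digit can be read off without the earlier ones.
\<close>

lemma ternary_digit:
  assumes "\<bar>r - tau b\<bar> \<le> (1 / 2) ^ (2 * n + 3)"
  shows "2 \<le> nat \<lfloor>3 ^ Suc n * r + 1 / 2\<rfloor> mod 6 \<longleftrightarrow> b n"
proof -
  obtain M where M: "tau_numerator b n = 2 * M" using even_tau_numerator by blast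
  define \<theta> where "\<theta> = tau (\<lambda>k. b (k + Suc n))"
  have \<theta>: "0 \<le> \<theta>" "\<theta> \<le> 1" unfolding \<theta>_def by (rule tau_bounds)+
  have "3 ^ Suc n * \<bar>r - tau b\<bar> \<le> 3 ^ Suc n * (1 / 2) ^ (2 * n + 3)"
    using assms by (intro mult_left_mono) simp_all
  also have "\<dots> = (3 / 4) ^ Suc n / (2::real)"
    by (simp add: power_add power_mult power_divide field_simps power2_eq_square
        flip: power_mult_distrib)
  also have "\<dots> < 1 / 2"
    using power_Suc_less_one[of "3/4 :: real" n] by simp
  finally have err: "\<bar>3 ^ Suc n * r - 3 ^ Suc n * tau b\<bar> < 1 / 2"
    by (simp add: abs_mult flip: right_diff_distrib)
  have "3 ^ Suc n * tau b = tau_numerator b (Suc n) + \<theta>"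
    using tau_split[of b "Suc n"] unfolding \<theta>_def by (simp add: field_simps)
  also have "\<dots> = 6 * M + 2 * of_bool (b n) + \<theta>" using M by simp
  finally have "6 * M + 2 * of_bool (b n) \<le> 3 ^ Suc n * r + 1 / 2"
    "3 ^ Suc n * r + 1 / 2 < 6 * M + 2 * of_bool (b n) + 2"
    using err \<theta> by linarith+
  then have "\<lfloor>3 ^ Suc n * r + 1 / 2\<rfloor> = int (6 * M + 2 * of_bool (b n)) \<or>
      \<lfloor>3 ^ Suc n * r + 1 / 2\<rfloor> = int (6 * M + 2 * of_bool (b n) + 1)"
    by (cases "b n") (simp_all, linarith+)
  then have "nat \<lfloor>3 ^ Suc n * r + 1 / 2\<rfloor> = 6 * M + 2 * of_bool (b n) \<or>
      nat \<lfloor>3 ^ Suc n * r + 1 / 2\<rfloor> = 6 * M + 2 * of_bool (b n) + 1"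
    by (metis nat_int)
  then obtain k where k: "nat \<lfloor>3 ^ Suc n * r + 1 / 2\<rfloor> = 6 * M + k"
    "k = 2 * of_bool (b n) \<or> k = 2 * of_bool (b n) + 1"
    by (metis add.assoc)
  then have "k < 6" by auto
  with k show ?thesis by (cases "b n") auto
qed

text \<open>
  The position at which the \<open>i\<close>-th block of zeros begins.
\<close>

definition block :: "baire \<Rightarrow> nat \<Rightarrow> nat" where
  "block w i = (\<Sum>k<i. Suc (w k))"

lemma le_block: "i \<le> block w i"
  by (induction i) (auto simp: block_def)

lemma unary_bits_block:
  assumes "r \<le> w i"
  shows "unary_bits w (block w i + r) \<longleftrightarrow> r = w i"
proof -
  let ?n = "block w i + r" and ?f = "\<lambda>i. replicate (w i) False @ [True]"
  have "i < Suc ?n" using le_block[of i w] by simp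
  then have "[0..<Suc ?n] = [0..<i] @ i # [Suc i..<Suc ?n]"
    by (metis le0 le_add_diff_inverse less_imp_le_nat upt_add_eq_append upt_conv_Cons)
  then have split: "concat (map ?f [0..<Suc ?n]) =
      concat (map ?f [0..<i]) @ ?f i @ concat (map ?f [Suc i..<Suc ?n])" by simp
  have "length (concat (map ?f [0..<i])) = block w i"
    by (induction i) (auto simp: block_def)
  then show ?thesis
    unfolding unary_bits_def split using assms by (auto simp: nth_append)
qed

lemma unary_bits_unbounded: "\<exists>y\<ge>x. unary_bits w y"
  using unary_bits_block[of "w x" w x] le_block[of x w] by (intro exI[of _ "block w x + w x"]) simp

context
  fixes p w b assumes p: "product_cauchy_name p (\<lambda>n. evaluations n (w, b))"
begin

lemma table_bit_eq: "table_bit p = b"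
proof
  fix n
  have "\<bar>rat_of_code (p (prod_encode (Suc n, 2))) - of_bool (b n)\<bar> \<le> (1 / 2) ^ 2"
    using p[unfolded product_cauchy_name_def rho_eq_Some_iff cauchy_names_def, rule_format, of "Suc n" 2]
    by simp
  also have "(1 / 2 :: real) ^ 2 = 1 / 4" by (simp add: power2_eq_square)
  finally show "table_bit p n = b n"
    unfolding table_bit_def by (cases "b n"; simp only: of_bool_eq simp_thms; linarith)
qed

lemma table_digit_eq: "table_digit p = unary_bits w"
proof
  fix n
  have "\<bar>rat_of_code (p (prod_encode (0, 2 * n + 3))) - tau (unary_bits w)\<bar> \<le> (1 / 2) ^ (2 * n + 3)"
    using p[unfolded product_cauchy_name_def rho_eq_Some_iff cauchy_names_def, rule_format, of 0 "2 * n + 3"]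
    by (simp add: kappa_def)
  then show "table_digit p n = unary_bits w n"
    unfolding table_digit_def by (rule ternary_digit)
qed

lemma next_digit_block: "next_digit p (block w i) = block w i + w i"
  unfolding next_digit_def table_digit_eq
proof (rule Least_equality)
  fix y assume y: "block w i \<le> y \<and> unary_bits w y"
  show "block w i + w i \<le> y"
  proof (rule ccontr)
    assume "\<not> block w i + w i \<le> y"
    with y have "y - block w i < w i" by linarith
    with y unary_bits_block[of "y - block w i" w i] show False by simp
  qed
qed (use unary_bits_block[of "w i" w i] in simp)

lemma table_point_eq: "table_point p = w"
proof
  fix i
  have "table_block p i = block w i"
    by (induction i) (simp_all add: next_digit_block, simp_all add: block_def)
  then show "table_point p i = w i" by (simp add: table_point_def next_digit_block)
qed

end

lemma decidable_table_bit:
  assumes "computable_on D n f"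
  shows "decidable_on D n (\<lambda>p xs. table_bit p (f p xs))"
  unfolding table_bit_def by (intro rational_intros computable_query computable_intros assms)

text \<open>
  The search for the next one terminates because the sequence of bits has infinitely many.
  For an oracle that names no table it may run forever.
\<close>

lemma computable_table_point:
  assumes "computable_on table_names n f"
  shows "computable_on table_names n (\<lambda>p xs. table_point p (f p xs))"
proof -
  have digit: "decidable_on D n (\<lambda>p xs. table_digit p (f p xs))" if "computable_on D n f" for D n f
    unfolding table_digit_def
    by (intro computable_floor rational_intros computable_query computable_intros that)
  have search: "computable_on table_names n (\<lambda>p xs. next_digit p (f p xs))"
    if f: "computable_on table_names n f" for n f
    unfolding next_digit_def
  proof (intro computable_Least digit computable_intros computable_weaken[OF f])
    fix p xs assume "p \<in> table_names"
    then obtain w b where "product_cauchy_name p (\<lambda>n. evaluations n (w, b))"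
      unfolding table_names_def by blast
    from table_digit_eq[OF this] unary_bits_unbounded[of "f p xs" w]
    show "\<exists>k. f p xs \<le> k \<and> table_digit p k" by simp
  qed simp_all
  have eq: "table_block p i = rec_nat 0 (\<lambda>_ x. Suc (next_digit p x)) i" for p i
    by (induction i) simp_all
  have "computable_on table_names n (\<lambda>p xs. table_block p (f p xs))"
    unfolding eq by (intro computable_rec search computable_intros assms) simp_all
  then show ?thesis unfolding table_point_def by (intro computable_intros search)
qed

section \<open>Upper bounds\<close>

text \<open>
  The functional with its natural domain; \<^const>\<open>rep_of\<close> provides the description because the output is
  unique.
\<close>

definition functional :: "scheme \<Rightarrow> baire \<rightharpoonup> baire" where
  "functional e = rep_of (\<lambda>p q. \<forall>n. runs p e [n] (q n))"

lemma functional_eq_Some_iff: "functional e p = Some q \<longleftrightarrow> (\<forall>n. runs p e [n] (q n))"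
  unfolding functional_def
  by (rule rep_of_eq_Some_iff, rule ext) (metis runs_deterministic)

lemma type2_computable_functional: "type2_computable (functional e)"
  unfolding type2_computable_def using functional_eq_Some_iff by blast

lemma computable_functional:
  assumes "computable_on D 1 (\<lambda>p xs. F p (hd xs))"
  obtains K where "type2_computable K" "\<And>p. p \<in> D \<Longrightarrow> K p = Some (F p)"
proof -
  obtain e where e: "\<And>p xs. p \<in> D \<Longrightarrow> length xs = 1 \<Longrightarrow> runs p e xs (F p (hd xs))"
    using assms unfolding computable_on_def by blast
  have "functional e p = Some (F p)" if "p \<in> D" for p
    unfolding functional_eq_Some_iff using e[OF that, of "[_]"] by simp
  then show thesis using that type2_computable_functional by blast
qed

text \<open>
  Solutions are compared only on the domain: off the domain, \<open>solutions R\<close> involves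
  \<open>the None\<close>.
\<close>

definition choice_problem :: "(baire \<times> cantor) problem \<Rightarrow> (baire \<rightharpoonup> real set) \<Rightarrow> bool" where
  "choice_problem R Z \<longleftrightarrow> inputs R = dom Z \<times> UNIV \<and> evaluation R = evaluations \<and>
    (\<forall>w b S. Z w = Some S \<longrightarrow> solutions R (w, b) = (\<lambda>z. shift b + ell * z) ` S)"

lemma choice_problem_input:
  assumes "choice_problem R Z" "input_name R p (w, b)"
  obtains S where "Z w = Some S" "solutions R (w, b) = (\<lambda>z. shift b + ell * z) ` S"
    "p \<in> table_names" "table_bit p = b" "table_point p = w"
proof -
  have name: "product_cauchy_name p (\<lambda>n. evaluations n (w, b))"
    using assms by (simp add: choice_problem_def input_name_def table_def)
  then have "p \<in> table_names" unfolding table_names_def by blast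
  moreover obtain S where "Z w = Some S"
    using assms by (auto simp: choice_problem_def input_name_def)
  moreover from this have "solutions R (w, b) = (\<lambda>z. shift b + ell * z) ` S"
    using assms(1) unfolding choice_problem_def by simp
  ultimately show thesis
    using that table_bit_eq[OF name] table_point_eq[OF name] by simp
qed

lemma solves_at_height_choice:
  assumes "choice_problem R Z"
    and "\<And>w b S p. Z w = Some S \<Longrightarrow> p \<in> table_names \<Longrightarrow> table_bit p = b \<Longrightarrow> table_point p = w \<Longrightarrow>
      \<exists>q r z. K p = Some q \<and> Lim_iter k q = Some r \<and> z \<in> S \<and> rho r = Some (shift b + ell * z)"
  shows "solves_at_height K k R"
  unfolding solves_at_height_def
proof (intro allI impI)
  fix x p assume "input_name R p x"
  then obtain w b where x: "x = (w, b)" "input_name R p (w, b)" by (cases x) auto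
  show "\<exists>q r y. K p = Some q \<and> Lim_iter k q = Some r \<and> rho r = Some y \<and> y \<in> solutions R x"
  proof (rule choice_problem_input[OF assms(1) x(2)])
    fix S assume S: "Z w = Some S" "solutions R (w, b) = (\<lambda>z. shift b + ell * z) ` S"
      "p \<in> table_names" "table_bit p = b" "table_point p = w"
    obtain q r z where "K p = Some q" "Lim_iter k q = Some r" "z \<in> S"
      "rho r = Some (shift b + ell * z)" using assms(2)[OF S(1,3,4,5)] by blast
    with S(2) x(1) show ?thesis by blast
  qed
qed

text \<open>
  The point is rounded down to the dyadic grid, so that \<open>answer\<close> can be used. Negative rational
  approximations are rounded to \<open>0\<close>, which is closer to the nonnegative \<open>z\<close>.
\<close>

lemma height_0_if_point_given:
  assumes "choice_problem R Z"
    and "\<And>w S. Z w = Some S \<Longrightarrow> \<exists>z\<in>S. 0 \<le> z \<and> rho (\<lambda>j. w (2 * j + 1)) = Some z"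
  shows "\<exists>K. type2_computable K \<and> solves_at_height K 0 R"
proof -
  define F where "F p j = answer (table_bit p) j
    (nat \<lfloor>2 ^ j * rat_of_code (table_point p (2 * j + 1))\<rfloor>)" for p j
  have "computable_on table_names 1 (\<lambda>p xs. F p (hd xs))"
    unfolding F_def
    by (intro computable_answer computable_floor rational_intros computable_intros
        computable_table_point decidable_table_bit) simp_all
  from computable_functional[OF this] obtain K where K: "type2_computable K"
    "\<And>p. p \<in> table_names \<Longrightarrow> K p = Some (F p)" by metis
  have "solves_at_height K 0 R"
  proof (rule solves_at_height_choice[OF assms(1)])
    fix w b S p assume S: "Z w = Some S" "p \<in> table_names" "table_bit p = b" "table_point p = w"
    obtain z where z: "z \<in> S" "0 \<le> z" "rho (\<lambda>j. w (2 * j + 1)) = Some z"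
      using assms(2)[OF S(1)] by blast
    have "\<bar>real (nat \<lfloor>2 ^ j * rat_of_code (w (2 * j + 1))\<rfloor>) / 2 ^ j - z\<bar> \<le> 2 / 2 ^ j" for j
    proof -
      define r where "r = rat_of_code (w (2 * j + 1))"
      have near: "\<bar>r - z\<bar> \<le> 1 / 2 ^ j"
        using z(3) unfolding r_def rho_eq_Some_iff cauchy_names_def by (simp add: power_divide)
      have "\<bar>real (nat \<lfloor>2 ^ j * r\<rfloor>) - 2 ^ j * z\<bar> \<le> 2"
      proof (cases "0 \<le> r")
        case True
        then have "\<bar>real (nat \<lfloor>2 ^ j * r\<rfloor>) - 2 ^ j * r\<bar> \<le> 1"
          by (simp add: of_nat_nat) linarith
        moreover have "\<bar>2 ^ j * r - 2 ^ j * z\<bar> \<le> 1"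
        proof -
          have "2 ^ j * \<bar>r - z\<bar> \<le> 1" using near by (simp add: field_simps)
          then show ?thesis by (simp add: abs_mult flip: right_diff_distrib)
        qed
        ultimately show ?thesis by linarith
      next
        case False
        then have "2 ^ j * r \<le> 0" by (simp add: mult_nonneg_nonpos)
        then have "nat \<lfloor>2 ^ j * r\<rfloor> = 0" by (simp add: floor_le_iff)
        moreover have "2 ^ j * z \<le> 1"
        proof -
          have "z \<le> 1 / 2 ^ j" using near False by linarith
          then show ?thesis by (simp add: field_simps)
        qed
        ultimately show ?thesis using z(2) by simp
      qed
      then have "\<bar>(real (nat \<lfloor>2 ^ j * r\<rfloor>) - 2 ^ j * z) / 2 ^ j\<bar> \<le> 2 / 2 ^ j"
        by (simp add: abs_divide divide_right_mono)
      then show ?thesis unfolding r_def by (simp add: diff_divide_distrib)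
    qed
    then have "rho (F p) = Some (shift b + ell * z)"
      unfolding F_def S by (rule rho_answer)
    with K(2) S z(1)
    show "\<exists>q r z. K p = Some q \<and> Lim_iter 0 q = Some r \<and> z \<in> S \<and> rho r = Some (shift b + ell * z)"
      by auto
  qed
  with K(1) show ?thesis by blast
qed

text \<open>
  The limits of the tests, \<open>M\<close>, guide the bisection to a point of the set. Only dyadic points
  in the unit interval matter, as the bisection visits no others.
\<close>

definition test_locates :: "(baire \<Rightarrow> nat \<Rightarrow> nat \<Rightarrow> nat \<Rightarrow> bool) \<Rightarrow> (baire \<rightharpoonup> real set) \<Rightarrow> bool" where
  "test_locates N Z \<longleftrightarrow> (\<forall>w S. Z w = Some S \<longrightarrow> (\<exists>M. \<exists>z\<in>S.
    (\<forall>k m. k < 2 ^ m \<longrightarrow> (\<forall>\<^sub>F s in sequentially. N w s k m = M k m)) \<and>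
    (\<forall>j. \<bar>bisect M j / 2 ^ j - z\<bar> \<le> 2 / 2 ^ j)))"

text \<open>
  The output at stage \<open>s\<close> is the result of a bisection that trusts the tests of stage \<open>s\<close>.
\<close>

lemma height_1_if_located:
  assumes "choice_problem R Z" "computable_test N" "test_locates N Z"
  shows "\<exists>K. type2_computable K \<and> solves_at_height K 1 R"
proof -
  define F where "F p n = (let s = fst (prod_decode n); j = snd (prod_decode n) in
    answer (table_bit p) j (bisect (N (table_point p) s) j))" for p n
  have point: "baire_computable_on table_names 1 (\<lambda>p xs. table_point p)"
    unfolding baire_computable_on_def by (intro computable_table_point computable_intros) simp
  have "computable_on table_names 1 (\<lambda>p xs. F p (hd xs))"
    unfolding F_def Let_def
    by (intro computable_answer computable_bisect assms(2) point computable_intros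
        decidable_table_bit) simp_all
  from computable_functional[OF this] obtain K where K: "type2_computable K"
    "\<And>p. p \<in> table_names \<Longrightarrow> K p = Some (F p)" by metis
  have "solves_at_height K 1 R"
  proof (rule solves_at_height_choice[OF assms(1)])
    fix w b S p assume S: "Z w = Some S" "p \<in> table_names" "table_bit p = b" "table_point p = w"
    obtain M z where z: "z \<in> S" "\<And>j. \<bar>bisect M j / 2 ^ j - z\<bar> \<le> 2 / 2 ^ j"
      and M: "\<And>k m. k < 2 ^ m \<Longrightarrow> \<forall>\<^sub>F s in sequentially. N w s k m = M k m"
      using assms(3) S(1) unfolding test_locates_def by metis
    have "Lim (F p) = Some (\<lambda>j. answer b j (bisect M j))"
      unfolding Lim_eq_Some_iff
    proof
      fix j
      have "\<forall>\<^sub>F s in sequentially. bisect (N w s) j = bisect M j"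
        by (rule eventually_bisect[OF M])
      then show "\<forall>\<^sub>F s in sequentially. F p (prod_encode (s, j)) = answer b j (bisect M j)"
        by eventually_elim (simp add: F_def S)
    qed
    moreover have "rho (\<lambda>j. answer b j (bisect M j)) = Some (shift b + ell * z)"
      by (rule rho_answer[OF z(2)])
    ultimately
    show "\<exists>q r z. K p = Some q \<and> Lim_iter 1 q = Some r \<and> z \<in> S \<and> rho r = Some (shift b + ell * z)"
      using K(2)[OF S(2)] z(1) by (auto simp: map_comp_def)
  qed
  with K(1) show ?thesis by blast
qed

text \<open>
  Instantiating the computability of the test with the oracle itself shows that it is
  continuous in the sequence that it tests.
\<close>

lemma computable_test_use:
  assumes "computable_test N"
  shows "\<exists>l. \<forall>w'. (\<forall>i<l. w' i = w i) \<longrightarrow> N w' s k m = N w s k m"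
proof -
  have "baire_computable_on UNIV 3 (\<lambda>p xs. p)"
    unfolding baire_computable_on_def by (intro computable_query computable_intros) simp
  then have "decidable_on UNIV 3 (\<lambda>p xs. N p (hd xs) (hd (tl xs)) (hd (tl (tl xs))))"
    using assms unfolding computable_test_def
    by (simp add: computable_var0 computable_var1 computable_var2)
  then obtain e where e: "\<And>p xs. length xs = 3 \<Longrightarrow>
      runs p e xs (of_bool (N p (hd xs) (hd (tl xs)) (hd (tl (tl xs)))))"
    unfolding computable_on_def by blast
  then have run: "runs p e [s, k, m] (of_bool (N p s k m))" for p
    by (metis length_Cons list.sel(1,3) list.size(3) numeral_3_eq_3)
  obtain l where "\<forall>w'. (\<forall>i<l. w' i = w i) \<longrightarrow> runs w' e [s, k, m] (of_bool (N w s k m))"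
    using runs_use[OF run[of w]] by blast
  then show ?thesis using runs_deterministic[OF run] by (metis of_bool_eq_iff)
qed

lemma Lim_prefix:
  assumes "Lim w = Some v"
  shows "\<forall>\<^sub>F t in sequentially. \<forall>i<l. w (prod_encode (t, i)) = v i"
proof (induction l)
  case (Suc l)
  have "\<forall>\<^sub>F t in sequentially. w (prod_encode (t, l)) = v l"
    using assms unfolding Lim_eq_Some_iff by blast
  with Suc show ?case by eventually_elim (auto simp: less_Suc_eq)
qed simp

text \<open>
  The inner limit lets the columns of \<open>w\<close> settle at a fixed stage of the tests, the outer limit
  lets the tests settle. The order matters: Lim is applied first to the index in front.
\<close>

lemma height_2_if_located:
  assumes "choice_problem R (Z \<circ>\<^sub>m Lim)" "computable_test N" "test_locates N Z"
  shows "\<exists>K. type2_computable K \<and> solves_at_height K 2 R"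
proof -
  define col where "col p t i = table_point p (prod_encode (t, i))" for p t i
  define F where "F p n = (let t = fst (prod_decode n); s = fst (prod_decode (snd (prod_decode n)));
    j = snd (prod_decode (snd (prod_decode n))) in
    answer (table_bit p) j (bisect (N (col p t) s) j))" for p n
  have point: "baire_computable_on table_names 1 (\<lambda>p xs. col p (fst (prod_decode (hd xs))))"
    unfolding baire_computable_on_def col_def by (intro computable_table_point computable_intros) simp_all
  have "computable_on table_names 1 (\<lambda>p xs. F p (hd xs))"
    unfolding F_def Let_def
    by (intro computable_answer computable_bisect[OF assms(2) point] computable_intros
        decidable_table_bit) simp_all
  from computable_functional[OF this] obtain K where K: "type2_computable K"
    "\<And>p. p \<in> table_names \<Longrightarrow> K p = Some (F p)" by metis
  have "solves_at_height K 2 R"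
  proof (rule solves_at_height_choice[OF assms(1)])
    fix w b S p assume S: "(Z \<circ>\<^sub>m Lim) w = Some S" "p \<in> table_names" "table_bit p = b" "table_point p = w"
    then obtain v where v: "Lim w = Some v" "Z v = Some S"
      by (auto simp: map_comp_def split: option.splits)
    obtain M z where z: "z \<in> S" "\<And>j. \<bar>bisect M j / 2 ^ j - z\<bar> \<le> 2 / 2 ^ j"
      and M: "\<And>k m. k < 2 ^ m \<Longrightarrow> \<forall>\<^sub>F s in sequentially. N v s k m = M k m"
      using assms(3) v(2) unfolding test_locates_def by metis
    have "Lim (F p) = Some (\<lambda>n. answer b (snd (prod_decode n))
        (bisect (N v (fst (prod_decode n))) (snd (prod_decode n))))"
      unfolding Lim_eq_Some_iff
    proof
      fix n
      define s j where "s = fst (prod_decode n)" and "j = snd (prod_decode n)"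
      have "\<forall>\<^sub>F t in sequentially. N (col p t) s k m = N v s k m" for k m
      proof -
        obtain l where l: "\<And>w'. \<forall>i<l. w' i = v i \<Longrightarrow> N w' s k m = N v s k m"
          using computable_test_use[OF assms(2)] by blast
        from Lim_prefix[OF v(1), of l] show ?thesis
          by eventually_elim (rule l, simp add: col_def S)
      qed
      then have "\<forall>\<^sub>F t in sequentially. bisect (N (col p t) s) j = bisect (N v s) j"
        by (rule eventually_bisect)
      then show "\<forall>\<^sub>F t in sequentially. F p (prod_encode (t, n)) = answer b (snd (prod_decode n))
        (bisect (N v (fst (prod_decode n))) (snd (prod_decode n)))"
        by eventually_elim (simp add: F_def S s_def j_def Let_def)
    qed
    moreover have "Lim (\<lambda>n. answer b (snd (prod_decode n))
        (bisect (N v (fst (prod_decode n))) (snd (prod_decode n)))) =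
        Some (\<lambda>j. answer b j (bisect M j))"
      unfolding Lim_eq_Some_iff
    proof
      fix j
      have "\<forall>\<^sub>F s in sequentially. bisect (N v s) j = bisect M j"
        by (rule eventually_bisect[OF M])
      then show "\<forall>\<^sub>F s in sequentially. answer b (snd (prod_decode (prod_encode (s, j))))
        (bisect (N v (fst (prod_decode (prod_encode (s, j))))) (snd (prod_decode (prod_encode (s, j))))) =
        answer b j (bisect M j)"
        by eventually_elim simp
    qed
    moreover have "rho (\<lambda>j. answer b j (bisect M j)) = Some (shift b + ell * z)"
      by (rule rho_answer[OF z(2)])
    ultimately
    show "\<exists>q r z. K p = Some q \<and> Lim_iter 2 q = Some r \<and> z \<in> S \<and> rho r = Some (shift b + ell * z)"
      using K(2)[OF S(2)] z(1) by (auto simp: map_comp_def numeral_2_eq_2)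
  qed
  with K(1) show ?thesis by blast
qed

section \<open>Negative information on the zeros of a function\<close>

text \<open>
  The \<open>s\<close>-th polygonal function is within \<open>1 / 2 ^ s\<close> of the function that is named. A negative value is
  therefore confirmed at all late stages, and a nonnegative value is never taken for a negative one.
\<close>

definition sign_test :: "baire \<Rightarrow> nat \<Rightarrow> nat \<Rightarrow> nat \<Rightarrow> bool" where
  "sign_test u s k m \<longleftrightarrow> polygonal (nodes_of_code (u s)) (real k / 2 ^ m) + 1 / 2 ^ s < 0"

lemma computable_sign_test: "computable_test sign_test"
  unfolding computable_test_def sign_test_def
proof (intro allI impI)
  fix D n W s k m
  assume W: "baire_computable_on D n W" and s: "computable_on D n s"
    and k: "computable_on D n k" and m: "computable_on D n m"
  show "decidable_on D n (\<lambda>p xs. polygonal (nodes_of_code (W p xs (s p xs)))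
    (real (k p xs) / 2 ^ m p xs) + 1 / 2 ^ s p xs < 0)"
    by (intro rational_intros rational_polygonal computable_app[OF W] s k m)
qed

definition delta_zeros :: "baire \<rightharpoonup> real set" where
  "delta_zeros u = map_option zeros (delta_H u)"

lemma delta_zeros_eq_Some_iff:
  "delta_zeros u = Some S \<longleftrightarrow> (\<exists>h. C_names u h \<and> h \<in> H_space \<and> S = zeros h)"
  unfolding delta_zeros_def delta_H_def
  by (auto simp: map_option_eq_Some rep_restrict_eq_Some_iff delta_C_eq_Some_iff)

lemma inverse_power_tendsto: "(\<lambda>j. 1 / 2 ^ j :: real) \<longlonglongrightarrow> 0"
  using LIMSEQ_realpow_zero[of "1/2 :: real"] by (simp add: power_divide)

lemma eventually_sign_test:
  assumes "C_names u h" "k < 2 ^ m"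
  shows "\<forall>\<^sub>F s in sequentially. sign_test u s k m = (h (real k / 2 ^ m) < 0)"
proof -
  let ?x = "real k / 2 ^ m"
  have "real k < 2 ^ m" using assms(2) by (metis of_nat_less_iff of_nat_numeral of_nat_power)
  then have x: "?x \<in> {0..1}" by simp
  then have near: "\<bar>polygonal (nodes_of_code (u s)) ?x - h ?x\<bar> \<le> 1 / 2 ^ s" for s
    using assms(1) by (auto simp: C_names_def power_divide)
  show ?thesis
  proof (cases "h ?x < 0")
    case True
    then have "\<forall>\<^sub>F s in sequentially. (1 / 2 ^ s :: real) < - h ?x / 2"
      by (intro order_tendstoD[OF inverse_power_tendsto]) simp
    then show ?thesis
    proof eventually_elim
      case (elim s)
      with near[of s] True show ?case unfolding sign_test_def by (simp add: abs_le_iff)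
    qed
  next
    case False
    have "\<not> sign_test u s k m" for s
      using near[of s] False unfolding sign_test_def by linarith
    with False show ?thesis by simp
  qed
qed

text \<open>
  The bracketing intervals are nested with lengths \<open>1 / 2 ^ j\<close>, so both ends tend to their common
  point.
\<close>

lemma bisect_converges:
  assumes "\<And>k m. M k m \<longleftrightarrow> P (real k / 2 ^ m)" "P 0" "\<not> P 1"
  obtains z where "\<And>j. bisect M j / 2 ^ j \<le> z" "\<And>j. z \<le> (bisect M j + 1) / 2 ^ j"
    "(\<lambda>j. bisect M j / 2 ^ j) \<longlonglongrightarrow> z" "(\<lambda>j. (bisect M j + 1) / 2 ^ j) \<longlonglongrightarrow> z"
proof -
  let ?f = "\<lambda>j. bisect M j / 2 ^ j :: real" and ?g = "\<lambda>j. (real (bisect M j) + 1) / 2 ^ j"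
  have "\<exists>z. ((\<forall>j. ?f j \<le> z) \<and> ?f \<longlonglongrightarrow> z) \<and> ((\<forall>j. z \<le> ?g j) \<and> ?g \<longlonglongrightarrow> z)"
  proof (rule nested_sequence_unique)
    show "(\<lambda>j. ?f j - ?g j) \<longlonglongrightarrow> 0"
      using tendsto_minus[OF inverse_power_tendsto] by (simp add: diff_divide_distrib[symmetric])
  qed (auto simp: field_simps)
  then show thesis using that by (auto simp: add.commute)
qed

text \<open>
  The function is negative at all left ends of the bisection and nonnegative at all right ends,
  so it vanishes at the common limit.
\<close>

lemma sign_test_locates: "test_locates sign_test delta_zeros"
  unfolding test_locates_def
proof (intro allI impI)
  fix u S assume "delta_zeros u = Some S"
  then obtain h where h: "C_names u h" "h \<in> H_space" "S = zeros h"
    unfolding delta_zeros_eq_Some_iff by blast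
  define M where "M k m \<longleftrightarrow> h (real k / 2 ^ m) < 0" for k m
  have P: "h 0 < 0" "\<not> h 1 < 0" "continuous_on {0..1} h"
    using h(2) by (auto simp: H_space_def C01_def)
  obtain z where le: "\<And>j. bisect M j / 2 ^ j \<le> z" "\<And>j. z \<le> (bisect M j + 1) / 2 ^ j"
    and lim: "(\<lambda>j. bisect M j / 2 ^ j) \<longlonglongrightarrow> z" "(\<lambda>j. (bisect M j + 1) / 2 ^ j) \<longlonglongrightarrow> z"
    by (rule bisect_converges[of M "\<lambda>x. h x < 0", OF M_def P(1,2)]) (rule that)
  have sign: "h (bisect M j / 2 ^ j) < 0" "0 \<le> h ((bisect M j + 1) / 2 ^ j)" for j
    using bisect_bracket[of M "\<lambda>x. h x < 0", OF M_def P(1,2), of j] by (auto simp: add.commute)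
  have mem: "bisect M j / 2 ^ j \<in> {0..1}" "(bisect M j + 1) / 2 ^ j \<in> {0..1}" for j
  proof -
    have "real (bisect M j + 1) \<le> real (2 ^ j)"
      using bisect_less[of M j] by (simp only: of_nat_le_iff Suc_eq_plus1[symmetric] Suc_le_eq)
    then show "bisect M j / 2 ^ j \<in> {0..1}" "(bisect M j + 1) / 2 ^ j \<in> {0..1}"
      using less_imp_le[OF bisect_less[of M j]] by (simp_all add: divide_le_eq)
  qed
  have z: "z \<in> {0..1}" using le[of 0] by simp
  have "h z \<le> 0"
  proof (rule LIMSEQ_le_const2)
    show "(\<lambda>j. h (bisect M j / 2 ^ j)) \<longlonglongrightarrow> h z"
      by (rule continuous_on_tendsto_compose[OF P(3) lim(1) z]) (use mem in simp)
  qed (use sign in \<open>auto intro: less_imp_le\<close>)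
  moreover have "0 \<le> h z"
  proof (rule LIMSEQ_le_const)
    show "(\<lambda>j. h ((bisect M j + 1) / 2 ^ j)) \<longlonglongrightarrow> h z"
      by (rule continuous_on_tendsto_compose[OF P(3) lim(2) z]) (use mem in simp)
  qed (use sign in auto)
  ultimately have "z \<in> S" using z h(3) by (simp add: zeros_def)
  moreover have "\<bar>bisect M j / 2 ^ j - z\<bar> \<le> 2 / 2 ^ j" for j
  proof -
    have "z \<le> bisect M j / 2 ^ j + 1 / 2 ^ j" using le(2)[of j] by (simp add: add_divide_distrib)
    moreover have "0 < (1 / 2 ^ j :: real)" "2 / 2 ^ j = 2 * (1 / 2 ^ j :: real)" by simp_all
    ultimately show ?thesis using le(1)[of j] by linarith
  qed
  ultimately show "\<exists>M. \<exists>z\<in>S. (\<forall>k m. k < 2 ^ m \<longrightarrow> (\<forall>\<^sub>F s in sequentially. sign_test u s k m = M k m)) \<and>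
      (\<forall>j. \<bar>bisect M j / 2 ^ j - z\<bar> \<le> 2 / 2 ^ j)"
    using eventually_sign_test[OF h(1)]
    by (intro exI[of _ M] bexI[of _ z]) (simp_all add: M_def)
qed

section \<open>Negative information on an interval\<close>

text \<open>
  The segment from \<open>0\<close> to \<open>k / 2 ^ m\<close> is cut into cells of length \<open>1 / 2 ^ s\<close>, and each cell is required to lie
  inside a single interval among the first \<open>s\<close> enumerated ones. This avoids computing unions of
  intervals.
\<close>

definition cover_test :: "baire \<Rightarrow> nat \<Rightarrow> nat \<Rightarrow> nat \<Rightarrow> bool" where
  "cover_test q s k m \<longleftrightarrow> (\<forall>i<Suc (k * 2 ^ s). i * 2 ^ m \<le> k * 2 ^ s \<longrightarrow>
    (\<exists>n<s. rat_of_code (fst (prod_decode (q n))) < real i / 2 ^ s \<and>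
      real (Suc i) / 2 ^ s < rat_of_code (snd (prod_decode (q n)))))"

lemma computable_cover_test: "computable_test cover_test"
  unfolding computable_test_def cover_test_def
proof (intro allI impI)
  fix D n W s k m
  assume W: "baire_computable_on D n W" and s: "computable_on D n s"
    and k: "computable_on D n k" and m: "computable_on D n m"
  show "decidable_on D n (\<lambda>p xs. \<forall>i<Suc (k p xs * 2 ^ s p xs). i * 2 ^ m p xs \<le> k p xs * 2 ^ s p xs \<longrightarrow>
    (\<exists>n<s p xs. rat_of_code (fst (prod_decode (W p xs n))) < real i / 2 ^ s p xs \<and>
      real (Suc i) / 2 ^ s p xs < rat_of_code (snd (prod_decode (W p xs n)))))"
    by (intro computable_intros rational_intros
        computable_app[OF baire_computable_weaken[OF baire_computable_weaken[OF W]]] s k m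
        computable_weaken[OF s] computable_weaken[OF k] computable_weaken[OF m]
        computable_weaken[OF computable_weaken[OF s]]) simp_all
qed

lemma open_of_code_eq:
  "open_of_code c = {rat_of_code (fst (prod_decode c))<..<rat_of_code (snd (prod_decode c))} \<inter> {0..1}"
  by (simp add: open_of_code_def split_beta)

text \<open>
  A Lebesgue number for a cover of a compact segment by open intervals, together with a finite
  subcover that realises it.
\<close>

lemma uniform_cover:
  fixes l r :: "nat \<Rightarrow> real"
  assumes "0 \<le> x" "\<And>y. 0 \<le> y \<Longrightarrow> y \<le> x \<Longrightarrow> \<exists>n. l n < y \<and> y < r n"
  shows "\<exists>d>0. \<exists>m. \<forall>y\<in>{0..x}. \<exists>n<m. l n < y \<and> y + d < r n"
proof -
  define P where "P a c \<longleftrightarrow> (\<exists>d>0. \<exists>m. \<forall>y\<in>{a..c}. \<exists>n<m. l n < y \<and> y + d < r n)" for a c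
  have "P 0 x"
    using assms(1)
  proof (induction rule: Bolzano)
    case (trans a b c)
    then obtain d1 m1 d2 m2 where "0 < d1" "0 < d2"
      and 1: "\<And>y. y \<in> {a..b} \<Longrightarrow> \<exists>n<m1. l n < y \<and> y + d1 < r n"
      and 2: "\<And>y. y \<in> {b..c} \<Longrightarrow> \<exists>n<m2. l n < y \<and> y + d2 < r n" unfolding P_def by metis
    have "\<exists>n<max m1 m2. l n < y \<and> y + min d1 d2 < r n" if "y \<in> {a..c}" for y
    proof (cases "y \<le> b")
      case True
      with 1[of y] that show ?thesis by (fastforce simp: less_max_iff_disj)
    next
      case False
      with 2[of y] that show ?thesis by (fastforce simp: less_max_iff_disj)
    qed
    then have "\<forall>y\<in>{a..c}. \<exists>n<max m1 m2. l n < y \<and> y + min d1 d2 < r n" by blast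
    moreover have "0 < min d1 d2" using \<open>0 < d1\<close> \<open>0 < d2\<close> by simp
    ultimately show ?case unfolding P_def by blast
  next
    case (local y)
    then obtain n where n: "l n < y" "y < r n" using assms(2) by blast
    define d where "d = min (y - l n) (r n - y) / 2"
    have d: "0 < d" "d \<le> (y - l n) / 2" "d \<le> (r n - y) / 2" using n by (auto simp: d_def)
    have "\<exists>n'<Suc n. l n' < t \<and> t + d < r n'" if "a \<le> y" "y \<le> b" "b - a < d" "t \<in> {a..b}" for a b t
      using that d by (intro exI[of _ n]) auto
    with d(1) show ?case unfolding P_def by blast
  qed
  then show ?thesis unfolding P_def .
qed

text \<open>
  To the left of \<open>a\<close> a Lebesgue number exceeds the cell length at late stages. At or to the right of
  \<open>a\<close> the cell that contains \<open>a\<close> can never be covered.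
\<close>

lemma eventually_cover_test:
  assumes "neg_names q {a..b}" "a \<in> {0<..<1}" "a \<le> b" "b \<le> 1"
  shows "\<forall>\<^sub>F s in sequentially. cover_test q s k m = (real k / 2 ^ m < a)"
proof (cases "real k / 2 ^ m < a")
  case True
  let ?x = "real k / 2 ^ m"
  let ?l = "\<lambda>n. rat_of_code (fst (prod_decode (q n)))" and ?r = "\<lambda>n. rat_of_code (snd (prod_decode (q n)))"
  have "\<exists>n. ?l n < y \<and> y < ?r n" if "0 \<le> y" "y \<le> ?x" for y
  proof -
    have "y \<in> {0..1} - {a..b}" using that True assms(2) by auto
    then have "y \<in> (\<Union>n. open_of_code (q n))" using assms(1) by (simp add: neg_names_def)
    then show ?thesis by (auto simp: open_of_code_eq)
  qed
  then have "\<exists>d>0. \<exists>M. \<forall>y\<in>{0..?x}. \<exists>n<M. ?l n < y \<and> y + d < ?r n"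
    by (intro uniform_cover) simp_all
  then obtain d M where d: "0 < d"
    "\<And>y. y \<in> {0..?x} \<Longrightarrow> \<exists>n<M. ?l n < y \<and> y + d < ?r n" by blast
  have "\<forall>\<^sub>F s in sequentially. (1 / 2 ^ s :: real) < d"
    using d(1) by (rule order_tendstoD[OF inverse_power_tendsto])
  with eventually_ge_at_top[of M] show ?thesis
  proof eventually_elim
    case (elim s)
    have "\<exists>n<s. ?l n < real i / 2 ^ s \<and> real (Suc i) / 2 ^ s < ?r n" if "i * 2 ^ m \<le> k * 2 ^ s" for i
    proof -
      have "real (i * 2 ^ m) \<le> real (k * 2 ^ s)" by (simp only: of_nat_le_iff that)
      then have "real i / 2 ^ s \<in> {0..?x}" by (simp add: field_simps)
      from d(2)[OF this] obtain n where "n < M" "?l n < real i / 2 ^ s" "real i / 2 ^ s + d < ?r n" by blast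
      moreover have "real (Suc i) / 2 ^ s = real i / 2 ^ s + 1 / 2 ^ s" by (simp add: add_divide_distrib)
      ultimately show ?thesis using elim by (intro exI[of _ n]) auto
    qed
    with True show ?case unfolding cover_test_def by blast
  qed
next
  case False
  have "\<not> cover_test q s k m" for s
  proof
    assume c: "cover_test q s k m"
    define i where "i = nat \<lfloor>a * 2 ^ s\<rfloor>"
    have "real i = of_int \<lfloor>a * 2 ^ s\<rfloor>" using assms(2) by (simp add: i_def)
    then have i: "real i / 2 ^ s \<le> a" "a < real (Suc i) / 2 ^ s"
      by (simp_all add: divide_le_eq less_divide_eq) linarith+
    then have "real i / 2 ^ s \<le> real k / 2 ^ m" using False by linarith
    then have "real (i * 2 ^ m) \<le> real (k * 2 ^ s)" by (simp add: field_simps)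
    then have le: "i * 2 ^ m \<le> k * 2 ^ s" by (simp only: of_nat_le_iff)
    moreover have "i \<le> i * 2 ^ m" by simp
    ultimately have "i < Suc (k * 2 ^ s)" by linarith
    with c le obtain n where "rat_of_code (fst (prod_decode (q n))) < real i / 2 ^ s"
      "real (Suc i) / 2 ^ s < rat_of_code (snd (prod_decode (q n)))"
      unfolding cover_test_def by blast
    with i have "a \<in> open_of_code (q n)" using assms(2) by (simp add: open_of_code_eq)
    then have "a \<in> {0..1} - {a..b}" using assms(1) unfolding neg_names_def by blast
    with assms(3) show False by simp
  qed
  with False show ?thesis by simp
qed

lemma delta_J_eq_Some_iff:
  "delta_J q = Some S \<longleftrightarrow> neg_names q S \<and> S \<in> J_space"
  by (simp add: delta_J_def rep_restrict_eq_Some_iff delta_neg_eq_Some_iff)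

lemma cover_test_locates: "test_locates cover_test delta_J"
  unfolding test_locates_def
proof (intro allI impI)
  fix q S assume "delta_J q = Some S"
  then obtain a b where S: "neg_names q {a..b}" "S = {a..b}" "1/3 \<le> a" "a \<le> b" "b \<le> 2/3"
    unfolding delta_J_eq_Some_iff J_space_def by blast
  define M where "M k m \<longleftrightarrow> real k / 2 ^ m < a" for k m
  have "bisect M j / 2 ^ j < a \<and> \<not> (bisect M j + 1) / 2 ^ j < a" for j
    using bisect_bracket[of M "\<lambda>x. x < a", OF M_def] S by auto
  then have "bisect M j / 2 ^ j < a" "a \<le> bisect M j / 2 ^ j + 1 / 2 ^ j" for j
    by (simp_all add: add_divide_distrib not_less add.commute)
  moreover have "0 < (1 / 2 ^ j :: real)" "2 / 2 ^ j = 2 * (1 / 2 ^ j :: real)" for j by simp_all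
  ultimately have "\<bar>bisect M j / 2 ^ j - a\<bar> \<le> 2 / 2 ^ j" for j
    by (smt (verit))
  moreover have "\<forall>\<^sub>F s in sequentially. cover_test q s k m = M k m" for k m
    unfolding M_def by (rule eventually_cover_test[OF S(1)]) (use S in auto)
  ultimately show "\<exists>M. \<exists>z\<in>S. (\<forall>k m. k < 2 ^ m \<longrightarrow> (\<forall>\<^sub>F s in sequentially. cover_test q s k m = M k m)) \<and>
      (\<forall>j. \<bar>bisect M j / 2 ^ j - z\<bar> \<le> 2 / 2 ^ j)"
    using S by (intro exI[of _ M] bexI[of _ a]) auto
qed

section \<open>Lower bounds\<close>

text \<open>
  A name that depends continuously on \<open>w\<close>: its entry at position \<open>x\<close> is determined by
  \<open>w 0, \<dots>, w x\<close>. The bits \<open>b\<close> are all \<^const>\<open>False\<close>.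
\<close>

definition canonical_name :: "baire \<Rightarrow> baire" where
  "canonical_name w x = (case prod_decode x of (n, j) \<Rightarrow>
    if n = 0 then prod_encode (2 * tau_numerator (unary_bits w) j, 2 * 3 ^ j)
    else prod_encode (2 * 0, 2 * 1))"

lemma tau_zero: "tau (\<lambda>_. False) = 0"
  by (simp add: tau_def)

lemma canonical_name: "product_cauchy_name (canonical_name w) (\<lambda>n. evaluations n (w, \<lambda>_. False))"
  unfolding product_cauchy_name_def rho_eq_Some_iff cauchy_names_def
proof (intro allI)
  fix n j
  show "\<bar>rat_of_code (canonical_name w (prod_encode (n, j))) - evaluations n (w, \<lambda>_. False)\<bar> \<le> (1 / 2) ^ j"
  proof (cases n)
    case 0
    have "rat_of_code (canonical_name w (prod_encode (0, j))) = tau_numerator (unary_bits w) j / 3 ^ j"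
      using rat_of_code_even[of "3 ^ j" "tau_numerator (unary_bits w) j"] by (simp add: canonical_name_def)
    moreover have "1 / 3 ^ j \<le> (1 / 2 :: real) ^ j"
      by (simp add: power_divide) (intro divide_left_mono power_mono; simp)
    ultimately show ?thesis
      using tau_tail[of "unary_bits w" j] unfolding 0 by (simp add: kappa_def abs_le_iff)
  next
    case (Suc n')
    then show ?thesis
      using rat_of_code_even[of 1 0] by (simp add: canonical_name_def)
  qed
qed

lemma canonical_name_cong:
  assumes "\<forall>i\<le>x. w' i = w i"
  shows "canonical_name w' x = canonical_name w x"
proof -
  obtain n j where x: "prod_decode x = (n, j)" by fastforce
  then have "j \<le> x" using le_prod_encode_2[of j n] by (metis prod_decode_inverse)
  have bits: "unary_bits w' k = unary_bits w k" if "k < j" for k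
  proof -
    have "map (\<lambda>i. replicate (w' i) False @ [True]) [0..<Suc k] =
        map (\<lambda>i. replicate (w i) False @ [True]) [0..<Suc k]"
      by (rule map_cong) (use assms \<open>k < j\<close> \<open>j \<le> x\<close> in auto)
    then show ?thesis unfolding unary_bits_def by (simp only:)
  qed
  have "l \<le> j \<Longrightarrow> tau_numerator (unary_bits w') l = tau_numerator (unary_bits w) l" for l
    by (induction l) (simp_all add: bits)
  then show ?thesis by (simp add: canonical_name_def x)
qed

lemma canonical_name_use:
  assumes "runs (canonical_name w) e xs y"
  shows "\<exists>m. \<forall>w'. (\<forall>i<m. w' i = w i) \<longrightarrow> runs (canonical_name w') e xs y"
proof -
  obtain m where m: "\<And>p'. \<forall>i<m. p' i = canonical_name w i \<Longrightarrow> runs p' e xs y"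
    using runs_use[OF assms] by blast
  have "runs (canonical_name w') e xs y" if "\<forall>i<m. w' i = w i" for w'
    by (rule m) (use that in \<open>auto intro!: canonical_name_cong\<close>)
  then show ?thesis by blast
qed

lemma input_name_canonical:
  assumes "choice_problem R Z" "Z w = Some S"
  shows "input_name R (canonical_name w) (w, \<lambda>_. False)"
  using assms canonical_name[of w] unfolding choice_problem_def input_name_def table_def by auto

definition end_point :: "bool \<Rightarrow> real" where
  "end_point right = (if right then 2/3 else 1/3)"

text \<open>
  The name \<open>v\<close> has to name some set, so that an algorithm is forced to answer on it.
\<close>

definition forks :: "(baire \<rightharpoonup> real set) \<Rightarrow> bool" where
  "forks Z \<longleftrightarrow> (\<exists>v S. Z v = Some S \<and>
    (\<forall>m right. \<exists>v'. (\<forall>i<m. v' i = v i) \<and> Z v' = Some {end_point right}))"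

text \<open>
  With all bits \<open>b\<close> equal to \<^const>\<open>False\<close> the answers for the end points \<open>1 / 3\<close> and \<open>2 / 3\<close> are \<open>1 / 3\<close> and \<open>5 / 12\<close>. Their
  midpoint is \<open>3 / 8\<close>, at distance \<open>1 / 24\<close>, which exceeds the error \<open>1 / 32\<close> of the approximation
  with index \<open>5\<close>.
\<close>

definition right_code :: "nat \<Rightarrow> bool" where
  "right_code c \<longleftrightarrow> 3 / 8 < rat_of_code c"

lemma right_code_rho:
  assumes "rho r = Some (shift (\<lambda>_. False) + ell * end_point right)"
  shows "right_code (r 5) = right"
proof -
  have "\<bar>rat_of_code (r 5) - (1 / 4 + 1 / 4 * end_point right)\<bar> \<le> 1 / 32"
    using assms unfolding rho_eq_Some_iff cauchy_names_def shift_def tau_zero ell_def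
    by (auto dest!: spec[of _ 5] simp: power_divide)
  then show ?thesis unfolding right_code_def end_point_def by (cases right; simp only: if_True if_False simp_thms; linarith)
qed

lemma not_height_0_if_forks:
  assumes R: "choice_problem R Z" and "forks Z" and "type2_computable K"
  shows "\<not> solves_at_height K 0 R"
proof
  assume solves: "solves_at_height K 0 R"
  obtain e where e: "\<And>p q. K p = Some q \<longleftrightarrow> (\<forall>n. runs p e [n] (q n))"
    using assms(3) unfolding type2_computable_def by blast
  have out: "\<exists>q z. (\<forall>n. runs (canonical_name w) e [n] (q n)) \<and> z \<in> S \<and>
      rho q = Some (shift (\<lambda>_. False) + ell * z)" if "Z w = Some S" for w S
  proof -
    have "solutions R (w, \<lambda>_. False) = (\<lambda>z. shift (\<lambda>_. False) + ell * z) ` S"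
      using R that unfolding choice_problem_def by blast
    with solves input_name_canonical[OF R that] show ?thesis
      unfolding solves_at_height_def by (fastforce simp: e)
  qed
  obtain v S where v: "Z v = Some S"
    "\<And>m right. \<exists>v'. (\<forall>i<m. v' i = v i) \<and> Z v' = Some {end_point right}"
    using assms(2) unfolding forks_def by blast
  obtain q where q: "\<And>n. runs (canonical_name v) e [n] (q n)" using out[OF v(1)] by blast
  obtain m where m: "\<And>w'. \<forall>i<m. w' i = v i \<Longrightarrow> runs (canonical_name w') e [5] (q 5)"
    using canonical_name_use[OF q] by blast
  obtain v' where v': "\<forall>i<m. v' i = v i" "Z v' = Some {end_point (\<not> right_code (q 5))}"
    using v(2) by blast
  obtain q' where q': "\<And>n. runs (canonical_name v') e [n] (q' n)"
    "rho q' = Some (shift (\<lambda>_. False) + ell * end_point (\<not> right_code (q 5)))"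
    using out[OF v'(2)] by blast
  have "q' 5 = q 5" using runs_deterministic[OF q'(1) m[OF v'(1)]] .
  with right_code_rho[OF q'(2)] show False by simp
qed

lemma Lim_eventually_column:
  assumes "\<And>x. N \<le> x \<Longrightarrow> w x = v (snd (prod_decode x))"
  shows "Lim w = Some v"
  unfolding Lim_eq_Some_iff
proof
  fix j
  show "\<forall>\<^sub>F s in sequentially. w (prod_encode (s, j)) = v j"
    using eventually_ge_at_top[of N]
  proof eventually_elim
    case (elim s)
    then show ?case using assms[of "prod_encode (s, j)"] le_prod_encode_1[of s j] by simp
  qed
qed

lemma Lim_iter_1: "Lim_iter 1 q = Lim q"
  by (simp add: map_comp_def)

lemma solves_at_heightD:
  assumes "solves_at_height K k R" "input_name R p x"
  shows "\<exists>q r y. K p = Some q \<and> Lim_iter k q = Some r \<and> rho r = Some y \<and> y \<in> solutions R x"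
  using assms(1)[unfolded solves_at_height_def, rule_format, OF assms(2)] .

text \<open>
  The columns \<open>w\<close> that refute the algorithm are the limit of finite modifications of the
  constant sequence of columns \<open>v\<close>. Every stage forces the guess, at two late indices, to
  opposite sides, by a finite prefix that all later stages respect.
\<close>

lemma not_height_1_if_forks:
  assumes R: "choice_problem R (Z \<circ>\<^sub>m Lim)" and "forks Z" and "type2_computable K"
  shows "\<not> solves_at_height K 1 R"
proof
  assume solves: "solves_at_height K 1 R"
  obtain e where e: "\<And>p q. K p = Some q \<longleftrightarrow> (\<forall>n. runs p e [n] (q n))"
    using assms(3) unfolding type2_computable_def by blast
  define ev where "ev w s c \<longleftrightarrow> runs (canonical_name w) e [prod_encode (s, 5)] c" for w s c
  have converges: "\<exists>c z. (\<forall>\<^sub>F s in sequentially. ev w s c) \<and> z \<in> S \<and>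
      (\<forall>right. z = end_point right \<longrightarrow> right_code c = right)"
    if "Lim w = Some u" "Z u = Some S" for w u S
  proof -
    have S: "(Z \<circ>\<^sub>m Lim) w = Some S" using that by simp
    then have sol: "solutions R (w, \<lambda>_. False) = (\<lambda>z. shift (\<lambda>_. False) + ell * z) ` S"
      using R unfolding choice_problem_def by blast
    have "\<exists>q r y. K (canonical_name w) = Some q \<and> Lim_iter 1 q = Some r \<and> rho r = Some y \<and>
        y \<in> solutions R (w, \<lambda>_. False)"
      by (rule solves_at_heightD[OF solves input_name_canonical[where Z = "Z \<circ>\<^sub>m Lim", OF R S]])
    then obtain q r z where q: "K (canonical_name w) = Some q" "Lim q = Some r" and
      z: "z \<in> S" "rho r = Some (shift (\<lambda>_. False) + ell * z)"
      unfolding Lim_iter_1 sol by (elim exE conjE imageE) simp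
    have "\<forall>\<^sub>F s in sequentially. q (prod_encode (s, 5)) = r 5"
      using q(2) unfolding Lim_eq_Some_iff by blast
    then have "\<forall>\<^sub>F s in sequentially. ev w s (r 5)"
    proof eventually_elim
      case (elim s)
      have "runs (canonical_name w) e [prod_encode (s, 5)] (q (prod_encode (s, 5)))"
        using q(1) e by blast
      with elim show ?case unfolding ev_def by simp
    qed
    moreover have "right_code (r 5) = right" if "z = end_point right" for right
      using right_code_rho z(2) that by blast
    ultimately show ?thesis using z(1) by (intro exI[of _ "r 5"] exI[of _ z]) simp
  qed
  have use: "\<exists>m. \<forall>w'. (\<forall>i<m. w' i = w i) \<longrightarrow> ev w' s c" if "ev w s c" for w s c
    using canonical_name_use[of w e] that unfolding ev_def by blast
  obtain v S where v: "Z v = Some S"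
    "\<And>m right. \<exists>v'. (\<forall>i<m. v' i = v i) \<and> Z v' = Some {end_point right}"
    using assms(2) unfolding forks_def by blast
  \<comment> \<open>From \<open>N\<close> on, all entries of \<open>w\<close> are those of the columns \<open>v\<close>.\<close>
  define default where "default w N \<longleftrightarrow> (\<forall>x\<ge>N. w x = v (snd (prod_decode x)))" for w and N :: nat
  \<comment> \<open>Stage \<open>k\<close> respects the prefix below \<open>N\<close>, leaves the columns below \<open>k\<close> alone, and makes the
    guess of the algorithm take both sides at indices beyond \<open>k\<close>.\<close>
  define extends where "extends k w N w' N' \<longleftrightarrow> N < N' \<and> (\<forall>x<N. w' x = w x) \<and>
      (\<forall>x\<ge>N. snd (prod_decode x) < k \<longrightarrow> w' x = v (snd (prod_decode x))) \<and>
      (\<exists>s1 s2 c1 c2. k \<le> s1 \<and> k \<le> s2 \<and> right_code c1 \<noteq> right_code c2 \<and>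
        (\<forall>u. (\<forall>x<N'. u x = w' x) \<longrightarrow> ev u s1 c1 \<and> ev u s2 c2))" for k w N w' N'
  have step: "\<exists>w' N'. default w' N' \<and> extends k w N w' N'" if def: "default w N" for k w N
  proof -
    have "Lim w = Some v" using def unfolding default_def by (intro Lim_eventually_column) blast
    from converges[OF this v(1)] obtain c1 where "\<forall>\<^sub>F s in sequentially. ev w s c1" by blast
    then obtain s1 where s1: "k \<le> s1" "ev w s1 c1"
      unfolding eventually_sequentially by (metis nat_le_linear)
    obtain m1 where m1: "\<And>u. \<forall>x<m1. u x = w x \<Longrightarrow> ev u s1 c1" using use[OF s1(2)] by blast
    define M where "M = max N m1"
    obtain v' where v': "\<forall>i<k. v' i = v i" "Z v' = Some {end_point (\<not> right_code c1)}"
      using v(2) by blast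
    \<comment> \<open>Switching from \<open>v\<close> to \<open>v'\<close> does not disturb the columns below \<open>k\<close>, on which the two agree.\<close>
    define w1 where "w1 x = (if x < M then w x else v' (snd (prod_decode x)))" for x
    have "Lim w1 = Some v'" by (rule Lim_eventually_column[of M]) (simp add: w1_def)
    from converges[OF this v'(2)] obtain c2 where c2: "\<forall>\<^sub>F s in sequentially. ev w1 s c2"
      "right_code c2 = (\<not> right_code c1)" by blast
    then obtain s2 where s2: "k \<le> s2" "ev w1 s2 c2"
      unfolding eventually_sequentially by (metis nat_le_linear)
    obtain m2 where m2: "\<And>u. \<forall>x<m2. u x = w1 x \<Longrightarrow> ev u s2 c2" using use[OF s2(2)] by blast
    define N' where "N' = Suc (max M m2)"
    define w' where "w' x = (if x < N' then w1 x else v (snd (prod_decode x)))" for x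
    have "ev u s1 c1" "ev u s2 c2" if "\<forall>x<N'. u x = w' x" for u
    proof -
      show "ev u s1 c1" by (rule m1) (use that in \<open>auto simp: w'_def w1_def M_def N'_def\<close>)
      show "ev u s2 c2" by (rule m2) (use that in \<open>auto simp: w'_def N'_def\<close>)
    qed
    moreover have "\<forall>x<N. w' x = w x" "N < N'" by (auto simp: w'_def w1_def M_def N'_def)
    moreover have "\<forall>x\<ge>N. snd (prod_decode x) < k \<longrightarrow> w' x = v (snd (prod_decode x))"
      using def v'(1) by (auto simp: w'_def w1_def default_def)
    ultimately have "extends k w N w' N'" using s1(1) s2(1) c2(2) unfolding extends_def by blast
    moreover have "default w' N'" by (simp add: default_def w'_def)
    ultimately show ?thesis by blast
  qed
  have "\<exists>f. \<forall>k. default (fst (f k)) (snd (f k)) \<and>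
      extends k (fst (f k)) (snd (f k)) (fst (f (Suc k))) (snd (f (Suc k)))"
  proof (rule dependent_nat_choice)
    show "\<exists>x. default (fst x) (snd x)"
      by (rule exI[of _ "(\<lambda>x. v (snd (prod_decode x)), 0)"]) (simp add: default_def)
    show "\<exists>y. default (fst y) (snd y) \<and> extends k (fst x) (snd x) (fst y) (snd y)"
      if "default (fst x) (snd x)" for x k
      using step[OF that, of k] by auto
  qed
  then obtain f where f: "\<And>k. default (fst (f k)) (snd (f k))"
    "\<And>k. extends k (fst (f k)) (snd (f k)) (fst (f (Suc k))) (snd (f (Suc k)))" by blast
  define W N where "W k = fst (f k)" and "N k = snd (f k)" for k
  have def: "default (W k) (N k)" and ext: "extends k (W k) (N k) (W (Suc k)) (N (Suc k))" for k
    unfolding W_def N_def using f by blast+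
  have "strict_mono N" using ext by (simp add: strict_mono_Suc_iff extends_def)
  then have le_N: "k \<le> N k" for k by (rule strict_mono_imp_increasing)
  \<comment> \<open>The stages agree below \<open>N k\<close>, so they have a pointwise limit.\<close>
  have agree: "W l x = W k x" if "k \<le> l" "x < N k" for k l x
    using that(1)
  proof (induction rule: dec_induct)
    case (step l)
    have "x < N l" using that(2) step(1) \<open>strict_mono N\<close> by (metis order_less_le_trans strict_mono_less_eq)
    then have "W (Suc l) x = W l x" using ext[of l] unfolding extends_def by blast
    with step show ?case by simp
  qed simp
  define w where "w x = W (Suc x) x" for x
  have w: "w x = W k x" if "x < N k" for x k
  proof -
    have "x < N (Suc x)" using le_N[of "Suc x"] by simp
    then show ?thesis unfolding w_def
      using agree[of k "Suc x" x] agree[of "Suc x" k x] that by (metis nat_le_linear)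
  qed
  have "Lim w = Some v"
    unfolding Lim_eq_Some_iff
  proof
    fix j
    have settled: "W k x = v j" if "Suc j \<le> k" "N (Suc j) \<le> x" "snd (prod_decode x) = j" for k x
      using that(1)
    proof (induction rule: dec_induct)
      case base
      show ?case using def[of "Suc j"] that unfolding default_def by blast
    next
      case (step k)
      show ?case
      proof (cases "x < N k")
        case True
        then have "W (Suc k) x = W k x" using ext[of k] unfolding extends_def by blast
        with step show ?thesis by simp
      next
        case False
        with ext[of k] step(1) that(3) show ?thesis unfolding extends_def by auto
      qed
    qed
    show "\<forall>\<^sub>F s in sequentially. w (prod_encode (s, j)) = v j"
      using eventually_ge_at_top[of "N (Suc j)"]
    proof eventually_elim
      case (elim s)
      let ?x = "prod_encode (s, j)"
      have "?x < N (max (Suc j) (Suc ?x))" using le_N[of "max (Suc j) (Suc ?x)"] by simp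
      moreover have "N (Suc j) \<le> ?x" using elim le_prod_encode_1[of s j] by simp
      ultimately show ?case using w[of ?x] settled[of "max (Suc j) (Suc ?x)" ?x] by simp
    qed
  qed
  from converges[OF this v(1)] obtain c where "\<forall>\<^sub>F s in sequentially. ev w s c" by blast
  then obtain k where k: "\<And>s. k \<le> s \<Longrightarrow> ev w s c" unfolding eventually_sequentially by blast
  obtain s1 s2 c1 c2 where s: "k \<le> s1" "k \<le> s2" and "right_code c1 \<noteq> right_code c2"
    and both: "\<And>u. \<forall>x<N (Suc k). u x = W (Suc k) x \<Longrightarrow> ev u s1 c1 \<and> ev u s2 c2"
    using ext[of k] unfolding extends_def by blast
  have "ev w s1 c1 \<and> ev w s2 c2" by (rule both) (use w in blast)
  with k[OF s(1)] k[OF s(2)] have "c = c1" "c = c2"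
    unfolding ev_def using runs_deterministic by blast+
  with \<open>right_code c1 \<noteq> right_code c2\<close> show False by simp
qed

text \<open>
  A sequence of constant columns converges to its column.
\<close>

lemma height_Suc:
  assumes "type2_computable K" "solves_at_height K 0 R"
  shows "\<exists>K'. type2_computable K' \<and> solves_at_height K' 1 R"
proof -
  obtain e where e: "\<And>p q. K p = Some q \<longleftrightarrow> (\<forall>n. runs p e [n] (q n))"
    using assms(1) unfolding type2_computable_def by blast
  define D where "D = dom K"
  have "computable_on D 1 (\<lambda>p xs. the (K p) (hd xs))"
    unfolding computable_on_def
  proof (intro exI[of _ e] ballI allI impI)
    fix p and xs :: "nat list" assume "p \<in> D" "length xs = 1"
    then obtain x q where "xs = [x]" "K p = Some q" unfolding D_def by (cases xs) auto
    then have "runs p e [x] (q x)" using e by blast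
    with \<open>xs = [x]\<close> \<open>K p = Some q\<close> show "runs p e xs (the (K p) (hd xs))" by simp
  qed
  then have "baire_computable_on D 0 (\<lambda>p xs. the (K p))" by (simp add: baire_computable_on_def)
  from baire_computable_weaken[OF this]
  have "computable_on D 1 (\<lambda>p xs. the (K p) (snd (prod_decode (hd xs))))"
    by (simp, rule computable_app) (intro computable_intros, simp)
  from computable_functional[OF this] obtain K' where K': "type2_computable K'"
    "\<And>p. p \<in> D \<Longrightarrow> K' p = Some (\<lambda>n. the (K p) (snd (prod_decode n)))" by metis
  have "solves_at_height K' 1 R"
    unfolding solves_at_height_def
  proof (intro allI impI)
    fix x p assume "input_name R p x"
    with assms(2) obtain q y where q: "K p = Some q" "rho q = Some y" "y \<in> solutions R x"
      unfolding solves_at_height_def by fastforce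
    have "Lim (\<lambda>n. q (snd (prod_decode n))) = Some q" by (rule Lim_eventually_column) simp
    with K'(2)[of p] q show "\<exists>q r y. K' p = Some q \<and> Lim_iter 1 q = Some r \<and> rho r = Some y \<and> y \<in> solutions R x"
      unfolding D_def by auto
  qed
  with K'(1) show ?thesis by blast
qed

section \<open>Forks in both representations\<close>

definition rat_code :: "rat \<Rightarrow> nat" where
  "rat_code = inv nat_to_rat_surj"

lemma nat_to_rat_surj_rat_code [simp]: "nat_to_rat_surj (rat_code r) = r"
  unfolding rat_code_def by (rule surj_f_inv_f[OF surj_nat_to_rat_surj])

definition interval_code :: "rat \<Rightarrow> rat \<Rightarrow> nat" where
  "interval_code a b = prod_encode (rat_code a, rat_code b)"

lemma open_interval_code: "open_of_code (interval_code a b) = {of_rat a<..<of_rat b} \<inter> {0..1}"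
  by (simp add: open_of_code_eq interval_code_def)

text \<open>
  An enumeration of the complement of an interval: its two components, over and over again.
\<close>

definition alternate :: "nat \<Rightarrow> nat \<Rightarrow> baire" where
  "alternate c d n = (if even n then c else d)"

lemma UN_alternate_tail:
  assumes "\<And>i. m \<le> i \<Longrightarrow> q i = alternate c d i"
  shows "f c \<union> f d \<subseteq> (\<Union>n. f (q n))"
proof -
  have "q (2 * m) = c" "q (2 * m + 1) = d" using assms by (simp_all add: alternate_def)
  then show ?thesis using UN_upper[of "2 * m" UNIV "\<lambda>n. f (q n)"] UN_upper[of "2 * m + 1" UNIV "\<lambda>n. f (q n)"]
    by simp
qed

text \<open>
  The first \<open>m\<close> entries leave a larger interval uncovered. This is consistent with the
  smaller one, whose complement is enumerated later.
\<close>

lemma delta_J_alternate: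
  fixes a b a' b' :: rat
  assumes "1/3 \<le> a'" "a' \<le> a" "a \<le> b" "b \<le> b'" "b' \<le> 2/3"
  shows "delta_J (\<lambda>i. if i < m then alternate (interval_code (- 1) a') (interval_code b' 2) i
      else alternate (interval_code (- 1) a) (interval_code b 2) i) = Some {of_rat a..of_rat b}"
    (is "delta_J ?q = _")
proof -
  have "real_of_rat (1/3) \<le> of_rat a'" "real_of_rat b' \<le> of_rat (2/3)"
    using assms by (simp_all only: of_rat_less_eq)
  then have r: "1/3 \<le> real_of_rat a'" "real_of_rat a' \<le> of_rat a" "real_of_rat a \<le> of_rat b"
    "real_of_rat b \<le> of_rat b'" "real_of_rat b' \<le> 2/3"
    using assms by (simp_all add: of_rat_less_eq of_rat_divide)
  have "open_of_code (?q n) \<subseteq> {0..1} - {of_rat a..of_rat b}" for n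
    using r by (auto simp: alternate_def open_interval_code)
  moreover have "{0..1} - {of_rat a..of_rat b} \<subseteq>
      open_of_code (interval_code (- 1) a) \<union> open_of_code (interval_code b 2)"
    by (auto simp: open_interval_code)
  ultimately have "(\<Union>n. open_of_code (?q n)) = {0..1} - {of_rat a..of_rat b}"
    using UN_alternate_tail[of m ?q "interval_code (- 1) a" "interval_code b 2" open_of_code]
    by (intro antisym UN_least) (simp_all, blast)
  moreover have "{of_rat a..of_rat b} \<in> J_space"
    unfolding J_space_def using r by (auto intro: exI[of _ "real_of_rat a"] exI[of _ "real_of_rat b"])
  moreover have "\<exists>s t. 0 \<le> s \<and> s \<le> t \<and> t \<le> 1 \<and> {real_of_rat a..of_rat b} = {s..t}"
  proof (intro exI conjI)
    show "{real_of_rat a..of_rat b} = {of_rat a..of_rat b}" by (rule refl)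
  qed (use r in linarith)+
  ultimately show ?thesis unfolding delta_J_eq_Some_iff neg_names_def by simp
qed

lemma forks_delta_J: "forks delta_J"
proof -
  let ?v = "alternate (interval_code (- 1) (1/3)) (interval_code (2/3) 2)"
  have v: "delta_J ?v = Some {of_rat (1/3)..of_rat (2/3)}"
    using delta_J_alternate[of "1/3" "1/3" "2/3" "2/3" 0] by simp
  have "\<exists>v'. (\<forall>i<m. v' i = ?v i) \<and> delta_J v' = Some {end_point right}" for m right
  proof -
    define e :: rat where "e = (if right then 2/3 else 1/3)"
    let ?w = "\<lambda>i. if i < m then ?v i else alternate (interval_code (- 1) e) (interval_code e 2) i"
    have "delta_J ?w = Some {of_rat e..of_rat e}"
      by (rule delta_J_alternate) (simp_all add: e_def)
    moreover have "of_rat e = end_point right" by (simp add: e_def end_point_def of_rat_divide)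
    ultimately show "\<exists>v'. (\<forall>i<m. v' i = ?v i) \<and> delta_J v' = Some {end_point right}"
      by (intro exI[of _ ?w]) simp
  qed
  with v show ?thesis unfolding forks_def by blast
qed

definition nodes_code :: "(rat \<times> rat) list \<Rightarrow> nat" where
  "nodes_code ns = list_encode (map (\<lambda>(a, c). prod_encode (rat_code a, rat_code c)) ns)"

lemma nodes_of_nodes_code [simp]: "nodes_of_code (nodes_code ns) = ns"
  by (auto simp: nodes_code_def nodes_of_code_def split_beta intro!: map_idI)

text \<open>
  For \<open>\<alpha> = \<beta> = 0\<close> the function vanishes exactly between \<open>1 / 3\<close> and \<open>2 / 3\<close>. Lowering it at \<open>1 / 3\<close> or raising it at
  \<open>2 / 3\<close> tilts the plateau and leaves a single zero at the other end.
\<close>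

definition plateau_nodes :: "rat \<Rightarrow> rat \<Rightarrow> (rat \<times> rat) list" where
  "plateau_nodes \<alpha> \<beta> = [(0, - 1), (1/3, - \<alpha>), (2/3, \<beta>), (1, 1)]"

definition plateau :: "rat \<Rightarrow> rat \<Rightarrow> real \<Rightarrow> real" where
  "plateau \<alpha> \<beta> = polygonal (plateau_nodes \<alpha> \<beta>)"

lemma valid_plateau_nodes: "valid_nodes (plateau_nodes \<alpha> \<beta>)"
  by (simp add: plateau_nodes_def valid_nodes_def)

lemma plateau_eq:
  "plateau \<alpha> \<beta> x =
    (if x \<le> 1/3 then - 1 + 3 * x * (1 - of_rat \<alpha>)
     else if x \<le> 2/3 then - of_rat \<alpha> + (3 * x - 1) * (of_rat \<alpha> + of_rat \<beta>)
     else if x \<le> 1 then of_rat \<beta> + (3 * x - 2) * (1 - of_rat \<beta>) else 1)"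
  by (simp add: plateau_def plateau_nodes_def of_rat_divide of_rat_minus field_simps)

text \<open>
  Clipped linear terms in place of the case distinction make continuity immediate.
\<close>

lemma plateau_eq_sum:
  assumes "x \<in> {0..1}"
  shows "plateau \<alpha> \<beta> x = - 1 + (1 - of_rat \<alpha>) * min 1 (3 * x) +
    (of_rat \<alpha> + of_rat \<beta>) * max 0 (min 1 (3 * x - 1)) + (1 - of_rat \<beta>) * max 0 (3 * x - 2)"
proof (cases "x = 1/3")
  case False
  with assms show ?thesis by (auto simp: plateau_eq min_def max_def algebra_simps)
next
  case True
  show ?thesis unfolding True by (simp add: plateau_eq)
qed

lemma continuous_on_plateau: "continuous_on {0..1} (plateau \<alpha> \<beta>)"
proof -
  have "continuous_on {0..1} (\<lambda>x. - 1 + (1 - of_rat \<alpha>) * min 1 (3 * x) +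
    (of_rat \<alpha> + of_rat \<beta>) * max 0 (min 1 (3 * x - 1)) + (1 - of_rat \<beta>) * max 0 (3 * x - 2) :: real)"
    by (intro continuous_intros)
  then show ?thesis by (rule continuous_on_cong[THEN iffD1, rotated -1]) (simp_all add: plateau_eq_sum)
qed

text \<open>
  The first \<open>m\<close> entries are those of the untilted function; they are good enough approximations of a
  function that is tilted by at most \<open>1 / 2 ^ m\<close>.
\<close>

definition plateau_name :: "nat \<Rightarrow> rat \<Rightarrow> rat \<Rightarrow> baire" where
  "plateau_name m \<alpha> \<beta> i = nodes_code (if i < m then plateau_nodes 0 0 else plateau_nodes \<alpha> \<beta>)"

text \<open>
  On the left third the functions differ by a fraction of \<open>\<alpha>\<close>, on the right third by a fraction of \<open>\<beta>\<close>,
  and in the middle by the difference of two such fractions.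
\<close>

lemma plateau_close:
  assumes "0 \<le> \<alpha>" "0 \<le> \<beta>" "\<alpha> \<le> \<epsilon>" "\<beta> \<le> \<epsilon>" "x \<in> {0..1}"
  shows "\<bar>plateau 0 0 x - plateau \<alpha> \<beta> x\<bar> \<le> of_rat \<epsilon>"
proof -
  define a b e where "a = real_of_rat \<alpha>" and "b = real_of_rat \<beta>" and "e = real_of_rat \<epsilon>"
  have ab: "0 \<le> a" "0 \<le> b" "a \<le> e" "b \<le> e"
    using assms unfolding a_def b_def e_def by (simp_all add: of_rat_less_eq)
  have convex: "t * a \<le> e" "t * b \<le> e" "0 \<le> t * a" "0 \<le> t * b" if "0 \<le> t" "t \<le> 1" for t
    using ab that mult_mono[of t 1 a e] mult_mono[of t 1 b e] by simp_all
  show ?thesis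
    unfolding plateau_eq a_def[symmetric] b_def[symmetric] e_def[symmetric]
    using assms(5) convex[of "3 * x"] convex[of "3 * x - 1"] convex[of "2 - 3 * x"] convex[of "3 - 3 * x"] ab
    by (auto simp: abs_le_iff algebra_simps)
qed

lemma delta_zeros_plateau:
  assumes "0 \<le> \<alpha>" "0 \<le> \<beta>" "\<alpha> \<le> (1 / 2) ^ m" "\<beta> \<le> (1 / 2) ^ m"
    and "{x\<in>{0..1}. plateau \<alpha> \<beta> x = 0} \<subseteq> {1/3..2/3}"
  shows "delta_zeros (plateau_name m \<alpha> \<beta>) = Some {x\<in>{0..1}. plateau \<alpha> \<beta> x = 0}"
proof -
  define h where "h = restrict (plateau \<alpha> \<beta>) {0..1}"
  have h: "h \<in> C01"
  proof -
    have "continuous_on {0..1} h \<longleftrightarrow> continuous_on {0..1} (plateau \<alpha> \<beta>)"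
      by (rule continuous_on_cong) (simp_all add: h_def)
    then show ?thesis using continuous_on_plateau by (simp add: C01_def h_def)
  qed
  have zeros: "zeros h = {x\<in>{0..1}. plateau \<alpha> \<beta> x = 0}"
    by (auto simp: zeros_def h_def)
  have "h \<in> H_space"
    using h assms(5) by (simp add: H_space_def zeros) (simp add: h_def plateau_eq)
  moreover have "C_names (plateau_name m \<alpha> \<beta>) h"
    unfolding C_names_def
  proof (intro conjI allI ballI h)
    fix n and x :: real assume x: "x \<in> {0..1}"
    show "\<bar>polygonal (nodes_of_code (plateau_name m \<alpha> \<beta> n)) x - h x\<bar> \<le> (1 / 2) ^ n"
    proof (cases "n < m")
      case True
      have "(1 / 2 :: rat) ^ m \<le> (1 / 2) ^ n" using True by (intro power_decreasing) simp_all
      then have "\<bar>plateau 0 0 x - plateau \<alpha> \<beta> x\<bar> \<le> of_rat ((1 / 2) ^ n)"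
        using assms x by (intro plateau_close) (auto intro: order_trans)
      then show ?thesis
        using True x by (simp add: plateau_name_def h_def plateau_def of_rat_power of_rat_divide)
    next
      case False
      then show ?thesis using x by (simp add: plateau_name_def h_def plateau_def)
    qed
  qed (simp add: plateau_name_def valid_plateau_nodes)
  ultimately show ?thesis unfolding delta_zeros_eq_Some_iff using zeros by metis
qed

lemma forks_delta_zeros: "forks delta_zeros"
proof -
  have v: "delta_zeros (plateau_name 0 0 0) = Some {x\<in>{0..1}. plateau 0 0 x = 0}"
    by (rule delta_zeros_plateau) (auto simp: plateau_eq split: if_splits)
  have "\<exists>v'. (\<forall>i<m. v' i = plateau_name 0 0 0 i) \<and> delta_zeros v' = Some {end_point right}" for m right
  proof -
    define \<epsilon> :: rat where "\<epsilon> = (1 / 2) ^ m"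
    define \<alpha> \<beta> where "\<alpha> = (if right then \<epsilon> else 0)" and "\<beta> = (if right then 0 else \<epsilon>)"
    have \<epsilon>: "0 < \<epsilon>" "\<epsilon> \<le> 1" by (simp_all add: \<epsilon>_def power_le_one)
    have zeros: "{x\<in>{0..1}. plateau \<alpha> \<beta> x = 0} = {end_point right}"
    proof -
      define e where "e = real_of_rat \<epsilon>"
      have e: "0 < e" "e \<le> 1" using \<epsilon> unfolding e_def by simp_all
      have zero: "plateau \<alpha> \<beta> x = 0 \<longleftrightarrow> x = end_point right" if x: "0 \<le> x" "x \<le> 1" for x
      proof (cases right)
        case True
        have l: "- 1 + 3 * x * (1 - e) < 0" if "x \<le> 1/3"
        proof -
          have "3 * x * (1 - e) \<le> 1 * (1 - e)" using that e by (intro mult_right_mono) simp_all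
          also have "1 * (1 - e) < 1" using e by simp
          finally show ?thesis by simp
        qed
        have "- e + (3 * x - 1) * e = e * (3 * x - 2)" by (simp add: algebra_simps)
        with l e x True show ?thesis
          by (auto simp: plateau_eq \<alpha>_def \<beta>_def end_point_def simp flip: e_def)
      next
        case False
        have r: "0 < e + (3 * x - 2) * (1 - e)" if "2/3 < x"
          using e that by (intro add_pos_nonneg mult_nonneg_nonneg) simp_all
        with e x False show ?thesis
          by (auto simp: plateau_eq \<alpha>_def \<beta>_def end_point_def simp flip: e_def)
      qed
      then show ?thesis by (auto simp: end_point_def)
    qed
    have "delta_zeros (plateau_name m \<alpha> \<beta>) = Some {x\<in>{0..1}. plateau \<alpha> \<beta> x = 0}"
    proof (rule delta_zeros_plateau)
      show "{x\<in>{0..1}. plateau \<alpha> \<beta> x = 0} \<subseteq> {1/3..2/3}"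
        unfolding zeros by (simp add: end_point_def)
    qed (use \<epsilon> in \<open>simp_all add: \<alpha>_def \<beta>_def \<epsilon>_def\<close>)
    then show "\<exists>v'. (\<forall>i<m. v' i = plateau_name 0 0 0 i) \<and> delta_zeros v' = Some {end_point right}"
      unfolding zeros by (intro exI[of _ "plateau_name m \<alpha> \<beta>"]) (simp add: plateau_name_def)
  qed
  with v show ?thesis unfolding forks_def by blast
qed

section \<open>The three tiers\<close>

text \<open>
  The set named by the even entries, provided that the odd entries name one of its points.
\<close>

definition with_point :: "(baire \<rightharpoonup> real set) \<Rightarrow> baire \<rightharpoonup> real set" where
  "with_point Z w = (case (Z (bfst w), rho (\<lambda>j. w (2 * j + 1))) of
    (Some S, Some z) \<Rightarrow> if z \<in> S then Some S else None | _ \<Rightarrow> None)"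

lemma with_point_eq_Some_iff:
  "with_point Z w = Some S \<longleftrightarrow> Z (bfst w) = Some S \<and> (\<exists>z\<in>S. rho (\<lambda>j. w (2 * j + 1)) = Some z)"
  by (auto simp: with_point_def split: option.splits if_splits)

lemma dom_with_point:
  "dom (with_point Z) = {bpair u v | u v. \<exists>S z. Z u = Some S \<and> rho v = Some z \<and> z \<in> S}"
proof -
  have "w = bpair (bfst w) (\<lambda>j. w (2 * j + 1))" for w
    by (rule ext) (simp add: bpair_def bfst_def)
  moreover have "(\<lambda>j. bpair u v (2 * j + 1)) = v" for u v
    by (rule ext) (simp add: bpair_def)
  ultimately show ?thesis
    unfolding dom_def with_point_eq_Some_iff not_None_eq
    by (auto simp: with_point_eq_Some_iff)
qed

text \<open>
  The three tiers differ only in how the set is named.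
\<close>

fun tier_sets :: "(baire \<rightharpoonup> real set) \<Rightarrow> tier \<Rightarrow> baire \<rightharpoonup> real set" where
  "tier_sets Z Tier_A = with_point Z"
| "tier_sets Z Tier_B = Z"
| "tier_sets Z Tier_C = Z \<circ>\<^sub>m Lim"

lemma choice_problem_P: "choice_problem (problem_P j) (tier_sets delta_zeros j)"
proof (cases j)
  case Tier_A
  have "D_H Tier_A = dom (with_point delta_zeros)"
    unfolding dom_with_point by (auto simp: delta_zeros_def) (metis domI option.sel, intro exI conjI, rule refl, auto)
  then show ?thesis unfolding Tier_A
    by (auto simp: choice_problem_def problem_P_def with_point_eq_Some_iff delta_zeros_def
        simp del: D_H.simps)
next
  case Tier_B
  have "dom delta_H = dom delta_zeros" by (auto simp: delta_zeros_def)
  then show ?thesis unfolding Tier_B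
    by (auto simp: choice_problem_def problem_P_def delta_zeros_def)
next
  case Tier_C
  have "{p \<in> dom Lim. the (Lim p) \<in> dom delta_H} = dom (delta_zeros \<circ>\<^sub>m Lim)"
    by (auto simp: delta_zeros_def map_comp_def split: option.splits)
  then show ?thesis unfolding Tier_C
    by (auto simp: choice_problem_def problem_P_def delta_zeros_def map_comp_Some_iff)
qed

lemma choice_problem_Q: "choice_problem (problem_Q j) (tier_sets delta_J j)"
proof (cases j)
  case Tier_A
  have "D_J Tier_A = dom (with_point delta_J)"
    unfolding dom_with_point by auto (metis domI option.sel, intro exI conjI, rule refl, auto)
  then show ?thesis unfolding Tier_A
    by (auto simp: choice_problem_def problem_Q_def with_point_eq_Some_iff simp del: D_J.simps)
next
  case Tier_B
  then show ?thesis unfolding Tier_B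
    by (auto simp: choice_problem_def problem_Q_def)
next
  case Tier_C
  have "{p \<in> dom Lim. the (Lim p) \<in> dom delta_J} = dom (delta_J \<circ>\<^sub>m Lim)"
    by (auto simp: map_comp_def split: option.splits)
  then show ?thesis unfolding Tier_C
    by (auto simp: choice_problem_def problem_Q_def map_comp_Some_iff)
qed

fun height :: "tier \<Rightarrow> nat" where
  "height Tier_A = 0" | "height Tier_B = 1" | "height Tier_C = 2"

lemma SCI_eqI:
  assumes "\<exists>K. type2_computable K \<and> solves_at_height K k R"
    and "\<And>i K. i < k \<Longrightarrow> type2_computable K \<Longrightarrow> \<not> solves_at_height K i R"
  shows "SCI_lim_mv_Comp R = enat k"
  unfolding SCI_lim_mv_Comp_def
proof (rule antisym)
  show "enat k \<le> Inf {enat k |k. \<exists>K. type2_computable K \<and> solves_at_height K k R}"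
    by (rule Inf_greatest) (use assms(2) in \<open>auto simp: not_less[symmetric]\<close>)
qed (rule Inf_lower, use assms(1) in blast)

lemma Lim_iter_dom:
  assumes "Lim_iter k q = Some r" "i \<le> k"
  shows "q \<in> dom (Lim_iter i)"
  using assms(2,1)
proof (induction arbitrary: r rule: inc_induct)
  case (step n)
  then obtain r' where "Lim_iter (Suc n) q = Some r'" by blast
  then show ?case by (auto simp: map_comp_Some_iff)
qed blast

lemma height_of_tier:
  assumes R: "choice_problem R (tier_sets Z j)"
    and Z: "computable_test N" "test_locates N Z" "forks Z" "\<And>w S. Z w = Some S \<Longrightarrow> S \<subseteq> {0..}"
  shows "\<exists>K. type2_computable K \<and> solves_at_height K (height j) R"
    and "SCI_lim_mv_Comp R = enat (height j)"
proof -
  show ex: "\<exists>K. type2_computable K \<and> solves_at_height K (height j) R"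
  proof (cases j)
    case Tier_A
    have "\<exists>K. type2_computable K \<and> solves_at_height K 0 R"
    proof (rule height_0_if_point_given[of R "with_point Z"])
      show "choice_problem R (with_point Z)" using R Tier_A by simp
      show "\<exists>z\<in>S. 0 \<le> z \<and> rho (\<lambda>j. w (2 * j + 1)) = Some z" if "with_point Z w = Some S" for w S
        using that Z(4) unfolding with_point_eq_Some_iff by fastforce
    qed
    then show ?thesis using Tier_A by simp
  next
    case Tier_B
    then show ?thesis using R height_1_if_located[OF _ Z(1,2), of R] by simp
  next
    case Tier_C
    then show ?thesis using R height_2_if_located[OF _ Z(1,2), of R] by simp
  qed
  show "SCI_lim_mv_Comp R = enat (height j)"
  proof (rule SCI_eqI[OF ex])
    fix i K assume i: "i < height j" and K: "type2_computable K"
    show "\<not> solves_at_height K i R"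
    proof (cases j)
      case Tier_A
      with i show ?thesis by simp
    next
      case Tier_B
      with i R not_height_0_if_forks[OF _ Z(3) K, of R] show ?thesis by simp
    next
      case Tier_C
      then have C: "choice_problem R (Z \<circ>\<^sub>m Lim)" using R by simp
      have 1: "\<not> solves_at_height K' 1 R" if "type2_computable K'" for K'
        by (rule not_height_1_if_forks[OF C Z(3) that])
      with height_Suc[OF K] have "\<not> solves_at_height K 0 R" by blast
      moreover have "i = 0 \<or> i = 1" using i Tier_C by auto
      ultimately show ?thesis using 1[OF K] by blast
    qed
  qed
qed

theorem theorem9p1:
  fixes R :: "tier \<Rightarrow> (baire \<times> cantor) problem"
  assumes "\<And>j. R j = problem_P j \<or> R j = problem_Q j"
  shows "SCI_lim_mv_Comp (R Tier_A) = 0 \<and> SCI_lim_mv_Comp (R Tier_B) = 1 \<and> SCI_lim_mv_Comp (R Tier_C) = 2 \<and>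
    (\<forall>(j, k) \<in> {(Tier_A, 0), (Tier_B, 1), (Tier_C, 2)}.
      \<exists>K. type2_computable K \<and>
        (\<forall>x p. input_name (R j) p x \<longrightarrow>
          (\<exists>q. K p = Some q \<and> (\<forall>i\<le>k. q \<in> dom (Lim_iter i)) \<and>
            (\<exists>r y. Lim_iter k q = Some r \<and> rho r = Some y \<and> y \<in> solutions (R j) x))))"
proof -
  have zeros: "S \<subseteq> {0..}" if "delta_zeros w = Some S" for w S
    using that unfolding delta_zeros_eq_Some_iff by (auto simp: zeros_def)
  have J: "S \<subseteq> {0..}" if "delta_J w = Some S" for w S
    using that unfolding delta_J_eq_Some_iff J_space_def by auto
  have upper: "\<exists>K. type2_computable K \<and> solves_at_height K (height j) (R j)"
    and SCI: "SCI_lim_mv_Comp (R j) = enat (height j)" for j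
  proof -
    obtain N Z where Z: "choice_problem (R j) (tier_sets Z j)" "computable_test N" "test_locates N Z"
      "forks Z" "\<And>w S. Z w = Some S \<Longrightarrow> S \<subseteq> {0..}"
      using assms[of j]
    proof
      assume "R j = problem_P j"
      then show thesis
        using that[OF _ computable_sign_test sign_test_locates forks_delta_zeros zeros]
          choice_problem_P[of j] by simp
    next
      assume "R j = problem_Q j"
      then show thesis
        using that[OF _ computable_cover_test cover_test_locates forks_delta_J J]
          choice_problem_Q[of j] by simp
    qed
    show "\<exists>K. type2_computable K \<and> solves_at_height K (height j) (R j)"
      using Z by (rule height_of_tier(1))
    show "SCI_lim_mv_Comp (R j) = enat (height j)"
      using Z by (rule height_of_tier(2))
  qed
  have "\<exists>K. type2_computable K \<and>
        (\<forall>x p. input_name (R j) p x \<longrightarrow>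
          (\<exists>q. K p = Some q \<and> (\<forall>i\<le>height j. q \<in> dom (Lim_iter i)) \<and>
            (\<exists>r y. Lim_iter (height j) q = Some r \<and> rho r = Some y \<and> y \<in> solutions (R j) x)))" for j
  proof -
    obtain K where K: "type2_computable K" "solves_at_height K (height j) (R j)"
      using upper[of j] by blast
    have "\<exists>q. K p = Some q \<and> (\<forall>i\<le>height j. q \<in> dom (Lim_iter i)) \<and>
        (\<exists>r y. Lim_iter (height j) q = Some r \<and> rho r = Some y \<and> y \<in> solutions (R j) x)"
      if "input_name (R j) p x" for x p
      using solves_at_heightD[OF K(2) that] Lim_iter_dom by blast
    with K(1) show ?thesis by blast
  qed
  from this[of Tier_A] this[of Tier_B] this[of Tier_C] SCI[of Tier_A] SCI[of Tier_B] SCI[of Tier_C]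
  show ?thesis by (simp add: zero_enat_def one_enat_def numeral_eq_enat)
qed

end
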